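(* Consider the original system under any admissible load balancing policy $\Pi$ and the modified system, with initial states satisfying $$Q_1^{(n,\Pi)}(0)=\tilde Q_1^{(n)}(0)\quad\text{and}\quad Q_{+2}^{(n,\Pi)}(0)=\tilde Q_2^{(n)}(0)\le\sum_{j=1}^MN_j^{(n)}.$$ Then there exists a coupling between the two systems such that for any $t\ge0$, $$\tilde Q_1^{(n)}(t)+\tilde Q_2^{(n)}(t)\le Q_1^{(n,\Pi)}(t)+Q_{+2}^{(n,\Pi)}(t)\quad\text{and}\quad \tilde Q_2^{(n)}(t)\le Q_{+2}^{(n,\Pi)}(t).$$
   Context: Original system: $M$ server types (pools) with speeds $\mu_1>\mu_2>\dots>\mu_M>0$; the $n$th system has $n$ parallel servers, $N_j^{(n)}$ of type $j$, $\sum_{j=1}^M N_j^{(n)}=n$. Each server has its own queue of infinite buffer and serves jobs First-Come-First-Served. Jobs arrive according to a Poisson process of rate $n\lambda^{(n)}$ with $\lambda^{(n)}<1$; the service time of a job at a type-$j$ server is exponential with rate $\mu_j$, independently of everything else. Each job is irrevocably assigned to a server upon arrival. A policy $\Pi$ is admissible if it dispatches each job arriving at time $t$ using only the present state of the system (the state and queue sizes of each server) and the server speeds. $Q^{(n,\Pi)}_{j,i}(t)$ is the number of type-$j$ servers with at least $i$ jobs at time $t$ under $\Pi$; $Q_1^{(n,\Pi)}(t)=\sum_{j=1}^MQ^{(n,\Pi)}_{j,1}(t)$ and $Q_{+2}^{(n,\Pi)}(t)=\sum_{j=1}^M\sum_{i=2}^\infty Q^{(n,\Pi)}_{j,i}(t)$.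 Modified system: it has the same servers ($N_j^{(n)}$ of rate $\mu_j$ in pool $j$) and $n$ queues, with the same arrival process law (Poisson of rate $n\lambda^{(n)}$), but the queues are not attached to servers: at any time the servers re-arrange themselves preemptively so that longer queues are always served by faster servers (one server per queue). Each queue has a buffer capacity of two jobs, including the one in service; arrivals occurring when all queues have two jobs are rejected. Each arriving job is irrevocably assigned to a queue by the conventional Join-the-Shortest-Queue policy (shortest queue, ties broken uniformly at random). $\tilde Q_i^{(n)}(t)$ is the number of queues with $i$ or more jobs at time $t$ in the modified system ($i=1,2$). Thus the total departure rate at time $t$ from queues with $i$ or more jobs is $\sum_{j=1}^M\mu_j\big[\big(\tilde Q_i^{(n)}(t-)-\sum_{k=1}^{j-1}N_k^{(n)}\big)_+\wedge N_j^{(n)}\big]$, where $(x)_+=\max\{x,0\}$. A coupling is a construction of both systems on a common probability space, each with its own law. *)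

theory Defs
  imports "HOL-Probability.Probability"
begin

section \<open>Markov jump processes on a countable state space\<close>

text \<open>
  A standard conservative transition function with off-diagonal rates \<open>q\<close>. The diagonal values
  \<open>q x x\<close> are never used, so a rate function may put mass there for events that do not change
  the state. If the exit rates are bounded, as they are for both systems below, \<open>q\<close> determines \<open>K\<close>.
\<close>

definition transition_function ::
  "('x::countable \<Rightarrow> 'x \<Rightarrow> real) \<Rightarrow> (real \<Rightarrow> 'x \<Rightarrow> 'x pmf) \<Rightarrow> bool" where
  "transition_function q K \<longleftrightarrow>
     (\<forall>x. K 0 x = return_pmf x) \<and>
     (\<forall>s\<ge>0. \<forall>t\<ge>0. \<forall>x. K (s + t) x = bind_pmf (K s x) (K t)) \<and>
     (\<forall>x y. x \<noteq> y \<longrightarrow> ((\<lambda>h. pmf (K h x) y / h) \<longlongrightarrow> q x y) (at_right 0)) \<and>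
     (\<forall>x. ((\<lambda>h. (1 - pmf (K h x) x) / h) \<longlongrightarrow> (\<Sum>\<^sub>\<infinity>y\<in>-{x}. q x y)) (at_right 0))"

text \<open>
  Paths are right-continuous with left limits in the discrete topology, i.e. piecewise constant with
  finitely many jumps in bounded time. The initial law is left open. Only times \<open>t \<ge> 0\<close> matter.
\<close>

definition markov_jump_process ::
  "'w measure \<Rightarrow> ('x::countable \<Rightarrow> 'x \<Rightarrow> real) \<Rightarrow> (real \<Rightarrow> 'w \<Rightarrow> 'x) \<Rightarrow> bool" where
  "markov_jump_process \<Omega> q X \<longleftrightarrow>
     prob_space \<Omega> \<and>
     (\<forall>t\<ge>0. X t \<in> measurable \<Omega> (count_space UNIV)) \<and>
     (\<forall>\<omega>\<in>space \<Omega>. \<forall>t\<ge>0. \<forall>\<^sub>F u in at_right t. X u \<omega> = X t \<omega>) \<and>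
     (\<forall>\<omega>\<in>space \<Omega>. \<forall>t>0. \<exists>x. \<forall>\<^sub>F u in at_left t. X u \<omega> = x) \<and>
     (\<exists>K. transition_function q K \<and>
       (\<forall>k (t :: nat \<Rightarrow> real) x. 0 \<le> t 0 \<longrightarrow> (\<forall>i\<le>k. t i \<le> t (Suc i)) \<longrightarrow>
          measure \<Omega> {\<omega> \<in> space \<Omega>. \<forall>i\<le>Suc k. X (t i) \<omega> = x i} =
          measure \<Omega> {\<omega> \<in> space \<Omega>. \<forall>i\<le>k. X (t i) \<omega> = x i} *
            pmf (K (t (Suc k) - t k) (x k)) (x (Suc k))))"

section \<open>Servers and occupancies\<close>

text \<open>
  The servers of the system form the finite type \<open>'v\<close>, so that \<open>n = CARD('v)\<close>; \<open>pool v\<close> is the type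
  of server \<open>v\<close>. A state \<open>x :: 'v \<Rightarrow> nat\<close> of the original system gives the number of jobs (including
  the one in service) at each server. By memorylessness of the exponential distribution, and because
  policies see only the present queue lengths, this is a Markov process irrespective of the identities
  of the jobs; the order of service (FCFS) does not affect it.
\<close>

definition pool_size :: "('v::finite \<Rightarrow> nat) \<Rightarrow> nat \<Rightarrow> nat" where
  "pool_size pool j = card {v. pool v = j}"

definition occ :: "('v::finite \<Rightarrow> nat) \<Rightarrow> nat \<Rightarrow> nat \<Rightarrow> ('v \<Rightarrow> nat) \<Rightarrow> nat" where
  "occ pool j i x = card {v. pool v = j \<and> i \<le> x v}"

definition Q1 :: "nat \<Rightarrow> ('v::finite \<Rightarrow> nat) \<Rightarrow> ('v \<Rightarrow> nat) \<Rightarrow> nat" where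
  "Q1 M pool x = (\<Sum>j=1..M. occ pool j 1 x)"

definition Q2plus :: "nat \<Rightarrow> ('v::finite \<Rightarrow> nat) \<Rightarrow> ('v \<Rightarrow> nat) \<Rightarrow> nat" where
  "Q2plus M pool x = (\<Sum>j=1..M. \<Sum>\<^sub>\<infinity>i\<in>{2..}. occ pool j i x)"

section \<open>The original system\<close>

text \<open>
  An admissible policy chooses the server of an arriving job from the present queue lengths only,
  possibly by a randomization that is independent of everything else. The speeds and pools are fixed
  parameters, so a policy may depend on them.
\<close>

type_synonym 'v policy = "('v \<Rightarrow> nat) \<Rightarrow> 'v pmf"

definition original_rate ::
  "real \<Rightarrow> (nat \<Rightarrow> real) \<Rightarrow> ('v::finite \<Rightarrow> nat) \<Rightarrow> 'v policy \<Rightarrow> ('v \<Rightarrow> nat) \<Rightarrow> ('v \<Rightarrow> nat) \<Rightarrow> real" where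
  "original_rate lam mu pool pol x x' =
     real CARD('v) * lam * pmf (map_pmf (\<lambda>v. x(v := x v + 1)) (pol x)) x' +
     (\<Sum>v | 0 < x v \<and> x' = x(v := x v - 1). mu (pool v))"

section \<open>The modified system\<close>

text \<open>
  The \<open>n\<close> queues of the modified system are labelled by the same type \<open>'v\<close>, but queue \<open>a\<close> is not
  attached to server \<open>a\<close>: in state \<open>y\<close> it is served by server \<open>arr y a\<close>. How the servers are arranged
  among queues of equal length is left to \<open>arr\<close>.
\<close>

definition rearrangement ::
  "(nat \<Rightarrow> real) \<Rightarrow> ('v::finite \<Rightarrow> nat) \<Rightarrow> (('v \<Rightarrow> nat) \<Rightarrow> 'v \<Rightarrow> 'v) \<Rightarrow> bool" where
  "rearrangement mu pool arr \<longleftrightarrow>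
     (\<forall>y. bij (arr y) \<and> (\<forall>a b. y b < y a \<longrightarrow> mu (pool (arr y b)) \<le> mu (pool (arr y a))))"

definition jsq :: "'v::finite policy" where
  "jsq y = pmf_of_set {a. \<forall>b. y a \<le> y b}"

text \<open>
  A job sent by JSQ to a queue that already holds two jobs is rejected; this happens only if all queues
  hold (at least) two jobs.
\<close>

definition modified_rate ::
  "real \<Rightarrow> (nat \<Rightarrow> real) \<Rightarrow> ('v::finite \<Rightarrow> nat) \<Rightarrow> (('v \<Rightarrow> nat) \<Rightarrow> 'v \<Rightarrow> 'v) \<Rightarrow>
     ('v \<Rightarrow> nat) \<Rightarrow> ('v \<Rightarrow> nat) \<Rightarrow> real" where
  "modified_rate lam mu pool arr y y' =
     real CARD('v) * lam *
       pmf (map_pmf (\<lambda>a. if y a < 2 then y(a := y a + 1) else y) (jsq y)) y' +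
     (\<Sum>a | 0 < y a \<and> y' = y(a := y a - 1). mu (pool (arr y a)))"

definition Qt :: "nat \<Rightarrow> ('v::finite \<Rightarrow> nat) \<Rightarrow> nat" where
  "Qt i y = card {a. i \<le> y a}"

text \<open>
  Sanity check: the total departure rate from the queues with \<open>i\<close> or more jobs. The truncated
  subtraction on \<open>nat\<close> is the positive part.
\<close>

lemma modified_departure_rate:
  fixes pool :: "'v::finite \<Rightarrow> nat"
  assumes arr: "rearrangement mu pool arr"
    and pool: "\<And>v. pool v \<in> {1..M}"
    and mu: "\<And>j k. 1 \<le> j \<Longrightarrow> j < k \<Longrightarrow> k \<le> M \<Longrightarrow> mu k < mu j"
  shows "(\<Sum>a | i \<le> y a. mu (pool (arr y a))) =
    (\<Sum>j=1..M. mu j * real (min (Qt i y - (\<Sum>k=1..<j. pool_size pool k)) (pool_size pool j)))"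
proof -
  define B where "B = arr y ` {a. i \<le> y a}"
  have bij: "bij (arr y)" and ord: "\<And>a b. y b < y a \<Longrightarrow> mu (pool (arr y b)) \<le> mu (pool (arr y a))"
    using arr by (auto simp: rearrangement_def)
  have inj: "inj_on (arr y) {a. i \<le> y a}"
    using bij by (meson bij_is_inj inj_on_subset subset_UNIV)
  have cardB: "card B = Qt i y"
    unfolding B_def Qt_def using inj by (rule card_image)
  have top: "pool v \<le> pool w" if v: "v \<in> B" and w: "w \<notin> B" for v w
  proof (rule ccontr)
    assume "\<not> pool v \<le> pool w"
    then have "mu (pool v) < mu (pool w)"
      using mu[of "pool w" "pool v"] pool[of v] pool[of w] by auto
    moreover obtain a where a: "v = arr y a" "i \<le> y a" using v by (auto simp: B_def)
    moreover obtain b where b: "w = arr y b" using bij by (meson bij_pointE)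
    moreover have "\<not> i \<le> y b" using w b by (auto simp: B_def)
    ultimately show False using ord[of b a] by auto
  qed
  have less: "(\<Sum>k=1..<j. pool_size pool k) = card {v. pool v < j}" for j
  proof -
    have "{v. pool v < j} = (\<Union>k\<in>{1..<j}. {v. pool v = k})" using pool by force
    then show ?thesis
      by (simp only: pool_size_def) (subst card_UN_disjoint; auto)
  qed
  have inpool: "card {v \<in> B. pool v = j} =
      min (Qt i y - (\<Sum>k=1..<j. pool_size pool k)) (pool_size pool j)" for j
  proof (cases "\<exists>v\<in>B. j \<le> pool v")
    case True
    then obtain v0 where "v0 \<in> B" "j \<le> pool v0" by auto
    then have sub: "{v. pool v < j} \<subseteq> B" using top by fastforce
    show ?thesis
    proof (cases "\<exists>v\<in>B. j < pool v")
      case True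
      then obtain v1 where "v1 \<in> B" "j < pool v1" by auto
      then have sub2: "{v. pool v = j} \<subseteq> B" using top by fastforce
      then have eq: "{v \<in> B. pool v = j} = {v. pool v = j}" by auto
      have "card ({v. pool v < j} \<union> {v. pool v = j}) \<le> card B"
        using sub sub2 by (intro card_mono) auto
      then have "card {v. pool v < j} + card {v. pool v = j} \<le> card B"
        by (subst (asm) card_Un_disjoint) auto
      then show ?thesis unfolding less eq cardB unfolding pool_size_def by simp
    next
      case False
      then have "B = {v. pool v < j} \<union> {v \<in> B. pool v = j}" using sub by fastforce
      moreover have disj: "{v. pool v < j} \<inter> {v \<in> B. pool v = j} = {}" by auto
      ultimately have "card B = card {v. pool v < j} + card {v \<in> B. pool v = j}"
        by (metis (lifting) finite disj card_Un_disjoint)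
      moreover have "card {v \<in> B. pool v = j} \<le> card {v. pool v = j}" by (intro card_mono) auto
      ultimately show ?thesis unfolding less cardB unfolding pool_size_def by simp
    qed
  next
    case False
    then have "B \<subseteq> {v. pool v < j}" by force
    then have "card B \<le> card {v. pool v < j}" by (intro card_mono) auto
    moreover have "{v \<in> B. pool v = j} = {}" using False by auto
    ultimately show ?thesis by (simp only: less cardB) simp
  qed
  have "(\<Sum>a | i \<le> y a. mu (pool (arr y a))) = (\<Sum>v\<in>B. mu (pool v))"
    unfolding B_def by (subst sum.reindex[OF inj]) simp
  also have "\<dots> = (\<Sum>j=1..M. \<Sum>v | v \<in> B \<and> pool v = j. mu (pool v))"
    by (rule sum.group[symmetric]) (use pool in auto)
  also have "\<dots> = (\<Sum>j=1..M. mu j * real (card {v \<in> B. pool v = j}))"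
    by (intro sum.cong) auto
  finally show ?thesis by (simp only: inpool)
qed

section \<open>Couplings\<close>

text \<open>
  Both systems on one probability space, each with its own law. \<open>\<rho>\<close> is the joint law of the initial
  states; deterministic initial states are \<open>\<rho> = return_pmf (x, y)\<close>.
\<close>

definition system_coupling ::
  "real \<Rightarrow> (nat \<Rightarrow> real) \<Rightarrow> ('v::finite \<Rightarrow> nat) \<Rightarrow> 'v policy \<Rightarrow> (('v \<Rightarrow> nat) \<Rightarrow> 'v \<Rightarrow> 'v) \<Rightarrow>
     (('v \<Rightarrow> nat) \<times> ('v \<Rightarrow> nat)) pmf \<Rightarrow> 'w measure \<Rightarrow>
     (real \<Rightarrow> 'w \<Rightarrow> ('v \<Rightarrow> nat)) \<Rightarrow> (real \<Rightarrow> 'w \<Rightarrow> ('v \<Rightarrow> nat)) \<Rightarrow> bool" where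
  "system_coupling lam mu pool pol arr \<rho> \<Omega> X Y \<longleftrightarrow>
     markov_jump_process \<Omega> (original_rate lam mu pool pol) X \<and>
     markov_jump_process \<Omega> (modified_rate lam mu pool arr) Y \<and>
     distr \<Omega> (count_space UNIV) (\<lambda>\<omega>. (X 0 \<omega>, Y 0 \<omega>)) = measure_pmf \<rho>"

end

theory Submission
  imports Defs "HOL-Real_Asymp.Real_Asymp"
begin

text \<open>
  Both systems are uniformized with the same rate \<open>L = n lam + \<Sum>\<^sub>v mu (pool v)\<close>: at the times of a Poisson
  process of rate \<open>L\<close>, an event takes place which is an arrival with probability \<open>n lam / L\<close>, and otherwise
  a possible service completion at a server drawn with probability proportional to its speed. A
  completion at an idle server changes nothing. It is therefore enough to couple a single event, such
  that either system makes the transition of its own kernel and such that the two inequalities are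
  preserved.

  For the coupling of one event, let a state of either system be given by its total number of jobs
  (\<open>total_jobs\<close>) and by the number of jobs that are not in service (\<open>waiting_jobs\<close>). The proposition asserts
  that both quantities are at most as large in the modified system. Arrivals are put into both systems
  at the same time. JSQ sends a job to a busy queue only if all queues are busy, and then a comparison of
  the totals shows that the second inequality survives (\<open>dominated_arrival\<close>). Departures are harmless
  except when one of the inequalities is an equality. In these cases the modified system has at least as many
  queues with two jobs, or at least as many busy queues, as the original system has servers of that
  kind; as its queues occupy the fastest servers, these have at least the same total speed
  (\<open>sum_le_sum_top\<close>). Drawing the two servers by the quantile functions of the same uniform
  variable, with longer queues first, lets a departure from the original system be accompanied by one
  of the same kind from the modified system (\<open>class_coupling\<close>, \<open>service_coupling\<close>, \<open>dominated_departure\<close>).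

  The remaining part constructs the continuous-time process that belongs to a kernel on pairs of
  states, and shows that each component is a Markov jump process with the prescribed rates.
  The process is driven by a sequence of exponential holding times and uniform variables.
  Lack of memory makes the sequence start afresh at any fixed time, independently of the present
  state (\<open>uniformization_split\<close>). Since the next value of each component depends on the pair only
  through this component, the finite-dimensional distributions of a component are products of its own
  transition probabilities (\<open>finite_dimensional_law\<close>), which are Poisson mixtures of the powers of
  its kernel and have the required derivatives at \<open>0\<close> (\<open>transition_function_uniformized_kernel\<close>).
\<close>

section \<open>Quantile functions and quantile couplings\<close>

definition cum_prob :: "'a pmf \<Rightarrow> ('a \<Rightarrow> nat) \<Rightarrow> nat \<Rightarrow> real" where
  "cum_prob p e k = measure_pmf.prob p {v. e v < k}"

text \<open>
  The atoms of \<open>p\<close> are laid out along \<open>[0, 1)\<close> in the order given by \<open>e\<close>, and \<open>u\<close> is mapped to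
  the atom whose interval contains it. Arguments outside \<open>[0, 1)\<close> go to some atom as well, so that
  every value lies in the support, not just almost every one.
\<close>

definition quantile :: "'a pmf \<Rightarrow> ('a \<Rightarrow> nat) \<Rightarrow> real \<Rightarrow> 'a" where
  "quantile p e u =
     (if \<exists>v\<in>set_pmf p. cum_prob p e (e v) \<le> u \<and> u < cum_prob p e (Suc (e v))
      then SOME v. v \<in> set_pmf p \<and> cum_prob p e (e v) \<le> u \<and> u < cum_prob p e (Suc (e v))
      else SOME v. v \<in> set_pmf p)"

lemma cum_prob_0 [simp]: "cum_prob p e 0 = 0"
  by (simp add: cum_prob_def)

lemma cum_prob_mono: "k \<le> l \<Longrightarrow> cum_prob p e k \<le> cum_prob p e l"
  unfolding cum_prob_def by (intro measure_pmf.finite_measure_mono) auto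

lemma cum_prob_Suc:
  assumes "inj e"
  shows "cum_prob p e (Suc (e v)) = cum_prob p e (e v) + pmf p v"
proof -
  have "{w. e w < Suc (e v)} = {w. e w < e v} \<union> {v}"
    using assms by (auto simp: less_Suc_eq inj_def)
  then show ?thesis
    unfolding cum_prob_def
    by (simp only:) (subst measure_pmf.finite_measure_Union; simp add: measure_pmf_single)
qed

lemma cum_prob_Suc_notin:
  assumes "inj e" "\<And>v. v \<in> set_pmf p \<Longrightarrow> e v \<noteq> k"
  shows "cum_prob p e (Suc k) = cum_prob p e k"
  unfolding cum_prob_def
  by (rule measure_pmf.finite_measure_eq_AE)
     (use assms in \<open>auto simp: AE_measure_pmf_iff less_Suc_eq\<close>)

lemma cum_prob_tendsto: "cum_prob p e \<longlonglongrightarrow> 1"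
proof -
  have "(\<lambda>k. measure_pmf.prob p {v. e v < k}) \<longlonglongrightarrow> measure_pmf.prob p (\<Union>k. {v. e v < k})"
    by (intro measure_pmf.finite_Lim_measure_incseq) (auto simp: incseq_def)
  moreover have "(\<Union>k. {v. e v < k}) = UNIV" by auto
  ultimately show ?thesis by (simp add: cum_prob_def[abs_def])
qed

lemma quantile_in_set_pmf: "quantile p e u \<in> set_pmf p"
proof (cases "\<exists>v\<in>set_pmf p. cum_prob p e (e v) \<le> u \<and> u < cum_prob p e (Suc (e v))")
  case True
  then have "\<exists>v. v \<in> set_pmf p \<and> cum_prob p e (e v) \<le> u \<and> u < cum_prob p e (Suc (e v))" by auto
  from someI_ex[OF this] True show ?thesis by (simp add: quantile_def)
next
  case False
  then show ?thesis using set_pmf_not_empty[of p] by (auto simp: quantile_def some_in_eq)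
qed

lemma quantile_bounds:
  assumes e: "inj e" and u: "0 \<le> u" "u < 1"
  shows "cum_prob p e (e (quantile p e u)) \<le> u" "u < cum_prob p e (Suc (e (quantile p e u)))"
proof -
  have "\<forall>\<^sub>F k in sequentially. u < cum_prob p e k"
    using cum_prob_tendsto u(2) by (rule order_tendstoD)
  then obtain k where k: "u < cum_prob p e k" by (auto simp: eventually_sequentially)
  define l where "l = (LEAST k. u < cum_prob p e k)"
  have l: "u < cum_prob p e l" and lmin: "\<And>i. i < l \<Longrightarrow> cum_prob p e i \<le> u"
    unfolding l_def using LeastI[of "\<lambda>k. u < cum_prob p e k", OF k] not_less_Least by force+
  have "l \<noteq> 0" using l u(1) by (metis cum_prob_0 not_less)
  then obtain j where j: "l = Suc j" using not0_implies_Suc by blast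
  have "cum_prob p e j < cum_prob p e (Suc j)" using l lmin[of j] j by simp
  then obtain v where "v \<in> set_pmf p" "e v = j"
    using cum_prob_Suc_notin[OF e, of p j] by force
  then have ex: "\<exists>v. v \<in> set_pmf p \<and> cum_prob p e (e v) \<le> u \<and> u < cum_prob p e (Suc (e v))"
    using l lmin j by auto
  then have "quantile p e u = (SOME v. v \<in> set_pmf p \<and> cum_prob p e (e v) \<le> u \<and> u < cum_prob p e (Suc (e v)))"
    by (auto simp: quantile_def)
  with someI_ex[OF ex] show "cum_prob p e (e (quantile p e u)) \<le> u"
      "u < cum_prob p e (Suc (e (quantile p e u)))"
    by auto
qed

text \<open>
  The reason for using quantiles: an initial segment in the order \<open>e\<close> is hit exactly by the
  parameters below its mass. Segments of different distributions are therefore comparable as soon as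
  their masses are.
\<close>

lemma quantile_less_iff:
  assumes "inj e" "0 \<le> u" "u < 1"
  shows "e (quantile p e u) < k \<longleftrightarrow> u < cum_prob p e k"
  using quantile_bounds[OF assms, of p] cum_prob_mono[of "Suc (e (quantile p e u))" k p e]
    cum_prob_mono[of k "e (quantile p e u)" p e]
  by (metis Suc_leI less_le_trans not_less order.trans)

lemma quantile_eq_iff:
  assumes "inj e" "0 \<le> u" "u < 1"
  shows "quantile p e u = v \<longleftrightarrow> cum_prob p e (e v) \<le> u \<and> u < cum_prob p e (Suc (e v))"
  using quantile_less_iff[OF assms, of p "e v"] quantile_less_iff[OF assms, of p "Suc (e v)"]
    quantile_bounds[OF assms, of p] assms(1)
  by (metis injD less_SucE not_less)

definition unif01 :: "real measure" where
  "unif01 = uniform_measure lborel {0..<1}"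

lemma sets_unif01 [measurable_cong, simp]: "sets unif01 = sets borel"
  by (simp add: unif01_def)

lemma space_unif01 [simp]: "space unif01 = UNIV"
  by (simp add: unif01_def)

lemma prob_space_unif01: "prob_space unif01"
  unfolding unif01_def by (intro prob_space_uniform_measure) auto

lemma emeasure_unif01:
  assumes "A \<in> sets borel"
  shows "emeasure unif01 A = emeasure lborel ({0..<1} \<inter> A)"
  using assms by (simp add: unif01_def divide_ennreal_def)

lemma AE_unif01: "AE u in unif01. 0 \<le> u \<and> u < 1"
  unfolding unif01_def by (intro AE_uniform_measureI) auto

lemma quantile_measurable [measurable]:
  fixes p :: "'a::countable pmf"
  assumes e: "inj e"
  shows "quantile p e \<in> measurable borel (count_space UNIV)"
proof -
  have "quantile p e -` {v} \<in> sets borel" for v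
  proof -
    have "quantile p e -` {v} =
        ({0..<1} \<inter> {cum_prob p e (e v)..<cum_prob p e (Suc (e v))}) \<union> (- {0..<1} \<inter> quantile p e -` {v})"
    proof -
      have "u \<in> quantile p e -` {v} \<longleftrightarrow> u \<in> {cum_prob p e (e v)..<cum_prob p e (Suc (e v))}"
        if "u \<in> {0..<1}" for u
        using quantile_eq_iff[OF e, of u p v] that by simp
      then show ?thesis by blast
    qed
    also have "- {0..<1} \<inter> quantile p e -` {v} = (if v = (SOME v. v \<in> set_pmf p) then - {0..<1} else {})"
    proof -
      have "quantile p e u = (SOME v. v \<in> set_pmf p)" if "u \<notin> {0..<1}" for u
      proof -
        have "cum_prob p e k \<le> 1" for k by (simp add: cum_prob_def)
        moreover have "0 \<le> cum_prob p e k" for k by (simp add: cum_prob_def)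
        ultimately have "\<not> (\<exists>v\<in>set_pmf p. cum_prob p e (e v) \<le> u \<and> u < cum_prob p e (Suc (e v)))"
          using that by (metis atLeastLessThan_iff less_le_trans order.trans)
        then show ?thesis by (simp only: quantile_def if_False)
      qed
      then show ?thesis by auto
    qed
    finally show ?thesis by simp
  qed
  then show ?thesis by (auto intro!: measurableI simp: measurable_count_space_eq2_countable)
qed

lemma distr_quantile:
  fixes p :: "'a::countable pmf"
  assumes e: "inj e"
  shows "distr unif01 (count_space UNIV) (quantile p e) = measure_pmf p"
proof (rule measure_eqI_countable[where A=UNIV])
  fix v :: 'a
  have cle: "cum_prob p e k \<le> 1" and cge: "0 \<le> cum_prob p e k" for k by (auto simp: cum_prob_def)
  have m: "quantile p e \<in> measurable unif01 (count_space UNIV)"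
    using quantile_measurable[OF e] by (simp cong: measurable_cong_sets)
  have "emeasure (distr unif01 (count_space UNIV) (quantile p e)) {v} =
      emeasure unif01 (quantile p e -` {v})"
    using m by (simp add: emeasure_distr)
  also have "\<dots> = emeasure lborel ({0..<1} \<inter> quantile p e -` {v})"
    using measurable_sets[OF quantile_measurable[OF e], of "{v}" p] by (intro emeasure_unif01) auto
  also have "{0..<1} \<inter> quantile p e -` {v} = {cum_prob p e (e v)..<cum_prob p e (Suc (e v))}"
  proof -
    have "u \<in> quantile p e -` {v} \<longleftrightarrow> u \<in> {cum_prob p e (e v)..<cum_prob p e (Suc (e v))}"
      if "u \<in> {0..<1}" for u
      using quantile_eq_iff[OF e, of u p v] that by simp
    moreover have "{cum_prob p e (e v)..<cum_prob p e (Suc (e v))} \<subseteq> {0..<1}"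
      using cle[of "Suc (e v)"] cge[of "e v"] by auto
    ultimately show ?thesis by blast
  qed
  also have "emeasure lborel \<dots> = pmf p v"
    by (simp add: cum_prob_Suc[OF e])
  finally show "emeasure (distr unif01 (count_space UNIV) (quantile p e)) {v} = emeasure p {v}"
    by (simp add: emeasure_pmf_single)
qed auto

lemma measure_to_pmf:
  fixes M :: "'a::countable measure"
  assumes "prob_space M" "sets M = UNIV"
  obtains p where "measure_pmf p = M"
proof -
  interpret prob_space M by fact
  have "AE x in M. measure M {x} \<noteq> 0"
  proof -
    have "{x. measure M {x} = 0} = (\<Union>x\<in>{x. measure M {x} = 0}. {x})" by auto
    moreover have "(\<Union>x\<in>{x. measure M {x} = 0}. {x}) \<in> null_sets M"
      using assms(2) by (intro null_sets_UN') (auto intro!: null_setsI simp: emeasure_eq_measure)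
    ultimately show ?thesis by (auto intro!: AE_I'[of "{x. measure M {x} = 0}"])
  qed
  then show ?thesis using assms by (intro that[of "Abs_pmf M"]) (simp add: Abs_pmf_inverse)
qed

text \<open>
  Both quantile functions are fed with the same uniform variable. Whenever an initial segment of \<open>p\<close> has
  at most the mass of an initial segment of \<open>q\<close>, the first one is hit only together with the second,
  and this holds for all such pairs of segments simultaneously.
\<close>

lemma quantile_coupling:
  fixes p :: "'a::countable pmf" and q :: "'b::countable pmf"
  assumes e: "inj e" and f: "inj f"
  obtains D where "map_pmf fst D = p" "map_pmf snd D = q"
    "\<And>v w k l. (v, w) \<in> set_pmf D \<Longrightarrow> cum_prob p e k \<le> cum_prob q f l \<Longrightarrow> e v < k \<Longrightarrow> f w < l"
proof -
  interpret prob_space unif01 by (rule prob_space_unif01)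
  let ?g = "\<lambda>u. (quantile p e u, quantile q f u)"
  note [measurable] = quantile_measurable[OF e] quantile_measurable[OF f]
  have g[measurable]: "?g \<in> measurable unif01 (count_space UNIV)"
  proof -
    have "?g \<in> measurable unif01 (count_space UNIV \<Otimes>\<^sub>M count_space UNIV)" by measurable
    then show ?thesis by (simp add: pair_measure_countable)
  qed
  obtain D where D: "measure_pmf D = distr unif01 (count_space UNIV) ?g"
    by (rule measure_to_pmf[of "distr unif01 (count_space UNIV) ?g"]) (auto intro: prob_space_distr)
  have "measure_pmf (map_pmf fst D) = measure_pmf p"
    unfolding map_pmf_rep_eq D by (subst distr_distr) (auto simp: comp_def distr_quantile[OF e])
  moreover have "measure_pmf (map_pmf snd D) = measure_pmf q"
    unfolding map_pmf_rep_eq D by (subst distr_distr) (auto simp: comp_def distr_quantile[OF f])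
  moreover have "f w < l" if vw: "(v, w) \<in> set_pmf D" "cum_prob p e k \<le> cum_prob q f l" "e v < k" for v w k l
  proof -
    have "AE u in unif01. e (quantile p e u) < k \<longrightarrow> f (quantile q f u) < l"
      using AE_unif01 by eventually_elim
        (use vw(2) in \<open>auto simp: quantile_less_iff[OF e] quantile_less_iff[OF f]\<close>)
    then have "AE z in measure_pmf D. e (fst z) < k \<longrightarrow> f (snd z) < l"
      unfolding D by (subst AE_distr_iff) auto
    then show ?thesis using vw by (auto simp: AE_measure_pmf_iff)
  qed
  ultimately show ?thesis using that by (auto simp: measure_pmf_inject)
qed

section \<open>Exponential clocks and Poisson numbers\<close>

text \<open>
  The rate may be zero, which is needed for the transition kernel at time \<open>0\<close>.
\<close>

definition poisson :: "real \<Rightarrow> nat pmf" where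
  "poisson r = (if 0 < r then poisson_pmf r else return_pmf 0)"

lemma pmf_poisson: "0 \<le> r \<Longrightarrow> pmf (poisson r) k = r ^ k / fact k * exp (- r)"
  by (cases "r = 0"; cases k) (auto simp: poisson_def)

primrec kernel_iterate :: "('x \<Rightarrow> 'x pmf) \<Rightarrow> nat \<Rightarrow> 'x \<Rightarrow> 'x pmf" where
  "kernel_iterate P 0 x = return_pmf x"
| "kernel_iterate P (Suc n) x = bind_pmf (P x) (kernel_iterate P n)"

definition clock :: "real \<Rightarrow> real measure" where
  "clock L = density lborel (exponential_density L)"

lemma sets_clock [measurable_cong, simp]: "sets (clock L) = sets borel"
  by (simp add: clock_def)

lemma space_clock [simp]: "space (clock L) = UNIV"
  by (simp add: clock_def)

lemma prob_space_clock: "0 < L \<Longrightarrow> prob_space (clock L)"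
  unfolding clock_def by (rule prob_space_exponential_density)

lemma nn_integral_clock:
  assumes [measurable]: "g \<in> borel_measurable borel" and "0 < L"
  shows "(\<integral>\<^sup>+e. g e \<partial>clock L) = (\<integral>\<^sup>+e. ennreal (L * exp (- L * e)) * indicator {0..} e * g e \<partial>lborel)"
  unfolding clock_def using assms(2)
  by (subst nn_integral_density)
     (auto intro!: nn_integral_cong simp: exponential_density_def indicator_def mult.commute)

text \<open>
  Lack of memory: given that the clock has not rung by time \<open>t\<close>, the time still to wait is distributed
  like the clock itself.
\<close>

lemma clock_memoryless:
  assumes [measurable]: "g \<in> borel_measurable borel" and L: "0 < L" and t: "0 \<le> t"
  shows "(\<integral>\<^sup>+e. indicator {t<..} e * g (e - t) \<partial>clock L) = ennreal (exp (- L * t)) * (\<integral>\<^sup>+e. g e \<partial>clock L)"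
proof -
  have "(\<integral>\<^sup>+e. indicator {t<..} e * g (e - t) \<partial>clock L) =
      (\<integral>\<^sup>+e. ennreal (L * exp (- L * e)) * indicator {0..} e * (indicator {t<..} e * g (e - t)) \<partial>lborel)"
    by (rule nn_integral_clock) (use L in auto)
  also have "\<dots> = (\<integral>\<^sup>+e. ennreal (L * exp (- L * (t + e))) * indicator {0..} (t + e) *
      (indicator {t<..} (t + e) * g e) \<partial>lborel)"
    by (subst nn_integral_real_affine[where t=t and c=1]) auto
  also have "\<dots> = (\<integral>\<^sup>+e. ennreal (exp (- L * t)) * (ennreal (L * exp (- L * e)) * indicator {0..} e * g e) \<partial>lborel)"
  proof (rule nn_integral_cong_AE)
    have "AE e in lborel. e \<noteq> (0::real)" by (rule AE_lborel_singleton)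
    then show "AE e in lborel. ennreal (L * exp (- L * (t + e))) * indicator {0..} (t + e) *
      (indicator {t<..} (t + e) * g e) =
      ennreal (exp (- L * t)) * (ennreal (L * exp (- L * e)) * indicator {0..} e * g e)"
    proof eventually_elim
      case (elim e)
      have "L * exp (- L * (t + e)) = exp (- L * t) * (L * exp (- L * e))"
        by (simp add: distrib_left exp_add exp_diff exp_minus field_simps)
      then show ?case using elim t L
        by (auto simp: indicator_def ennreal_mult' mult_ac)
    qed
  qed
  also have "\<dots> = ennreal (exp (- L * t)) * (\<integral>\<^sup>+e. g e \<partial>clock L)"
    using L by (subst nn_integral_cmult) (auto simp: nn_integral_clock)
  finally show ?thesis .
qed

text \<open>
  Decomposing according to the first ring \<open>e\<close>: having \<open>n + 1\<close> rings by time \<open>t\<close> means having \<open>n\<close> more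
  rings in the remaining time \<open>t - e\<close>.
\<close>

lemma clock_poisson_step:
  assumes L: "0 < L" and t: "0 \<le> t"
  shows "(\<integral>\<^sup>+e. indicator {0..t} e * ennreal (pmf (poisson (L * (t - e))) n) \<partial>clock L) =
    ennreal (pmf (poisson (L * t)) (Suc n))"
proof -
  let ?f = "\<lambda>e. L * exp (- L * t) * ((L * (t - e)) ^ n / fact n)"
  let ?F = "\<lambda>e. - exp (- L * t) * ((L * (t - e)) ^ Suc n / fact (Suc n))"
  have "(\<integral>\<^sup>+e. indicator {0..t} e * ennreal (pmf (poisson (L * (t - e))) n) \<partial>clock L) =
    (\<integral>\<^sup>+e. indicator {0..t} e * ennreal ((L * (t - e)) ^ n / fact n * exp (- (L * (t - e)))) \<partial>clock L)"
    using L by (intro nn_integral_cong) (auto simp: pmf_poisson split: split_indicator)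
  also have "\<dots> = (\<integral>\<^sup>+e. ennreal (L * exp (- L * e)) * indicator {0..} e *
      (indicator {0..t} e * ennreal ((L * (t - e)) ^ n / fact n * exp (- (L * (t - e))))) \<partial>lborel)"
    by (rule nn_integral_clock) (use L in auto)
  also have "\<dots> = (\<integral>\<^sup>+e. ennreal (?f e) * indicator {0..t} e \<partial>lborel)"
  proof (intro nn_integral_cong)
    fix e
    have "L * exp (- L * e) * ((L * (t - e)) ^ n / fact n * exp (- (L * (t - e)))) = ?f e"
      by (simp add: right_diff_distrib exp_diff exp_minus field_simps)
    then show "ennreal (L * exp (- L * e)) * indicator {0..} e *
      (indicator {0..t} e * ennreal ((L * (t - e)) ^ n / fact n * exp (- (L * (t - e))))) =
      ennreal (?f e) * indicator {0..t} e"
      using L by (auto simp: indicator_def ennreal_mult'[symmetric])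
  qed
  also have "\<dots> = ennreal (?F t - ?F 0)"
  proof (rule nn_integral_FTC_Icc)
    fix e :: real
    have "((\<lambda>e. (L * (t - e)) ^ Suc n) has_real_derivative
        real (Suc n) * (L * (t - e)) ^ n * (- L)) (at e)"
    proof -
      have "((\<lambda>e. L * (t - e)) has_real_derivative - L) (at e)"
        by (auto intro!: derivative_eq_intros)
      from DERIV_power[OF this, of "Suc n"] show ?thesis
        by (simp add: mult_ac)
    qed
    note D = this
    have F: "?F = (\<lambda>e. (- exp (- L * t) / fact (Suc n)) * (L * (t - e)) ^ Suc n)"
      by (simp del: power_Suc fact_Suc)
    show "(?F has_real_derivative ?f e) (at e)"
      unfolding F by (rule DERIV_cong[OF DERIV_cmult[OF D]]) (simp add: divide_simps del: of_nat_Suc)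
  qed (use L t in auto)
  also have "?F t - ?F 0 = pmf (poisson (L * t)) (Suc n)"
    using L t by (simp add: pmf_poisson)
  finally show ?thesis .
qed

section \<open>Jump chains driven by noise\<close>

text \<open>
  Each step of the construction consumes an exponential holding time and an independent uniform
  variable, from which the next state is drawn by its quantile function.
\<close>

definition step_noise :: "real \<Rightarrow> (real \<times> real) measure" where
  "step_noise L = clock L \<Otimes>\<^sub>M unif01"

definition noise :: "real \<Rightarrow> (nat \<Rightarrow> real \<times> real) measure" where
  "noise L = (\<Pi>\<^sub>M i\<in>UNIV. step_noise L)"

lemma sets_step_noise [measurable_cong, simp]: "sets (step_noise L) = sets (borel \<Otimes>\<^sub>M borel)"
  unfolding step_noise_def by (intro sets_pair_measure_cong) auto

lemma space_step_noise [simp]: "space (step_noise L) = UNIV"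
  by (simp add: step_noise_def space_pair_measure)

lemma prob_space_step_noise: "0 < L \<Longrightarrow> prob_space (step_noise L)"
  unfolding step_noise_def
  by (intro prob_space_pair prob_space_clock prob_space_unif01)

lemma sets_noise [measurable_cong]:
  "sets (noise L) = sets (\<Pi>\<^sub>M i\<in>(UNIV::nat set). borel \<Otimes>\<^sub>M (borel :: real measure) :: (real \<times> real) measure)"
  unfolding noise_def by (intro sets_PiM_cong) auto

lemma space_noise [simp]: "space (noise L) = UNIV"
  by (simp add: noise_def space_PiM)

lemma prob_space_noise: "0 < L \<Longrightarrow> prob_space (noise L)"
  unfolding noise_def by (intro prob_space_PiM prob_space_step_noise)

definition tail :: "(nat \<Rightarrow> 'a) \<Rightarrow> nat \<Rightarrow> 'a" where
  "tail w = (\<lambda>n. w (Suc n))"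

lemma tail_case_nat [simp]: "tail (case_nat a w) = w"
  by (simp add: tail_def)

lemma noise_nth [measurable]: "(\<lambda>w. w n) \<in> measurable (noise L) (borel \<Otimes>\<^sub>M borel)"
  by measurable

lemma tail_measurable [measurable]: "tail \<in> measurable (noise L) (noise L)"
  unfolding tail_def[abs_def] noise_def
  by (rule measurable_PiM_single') (auto intro!: measurable_component_singleton)

lemma case_nat_noise [measurable]:
  assumes [measurable]: "f \<in> measurable M (borel \<Otimes>\<^sub>M borel)" "g \<in> measurable M (noise L)"
  shows "(\<lambda>x. case_nat (f x) (g x)) \<in> measurable M (noise L)"
proof -
  have g: "(\<lambda>x. g x n) \<in> measurable M (borel \<Otimes>\<^sub>M borel)" for n by measurable
  show ?thesis
    unfolding noise_def
  proof (rule measurable_PiM_single')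
    fix i :: nat
    show "(\<lambda>x. case_nat (f x) (g x) i) \<in> measurable M (step_noise L)"
      using g by (cases i) auto
  qed auto
qed

lemma nn_integral_noise_iter:
  assumes L: "0 < L" and [measurable]: "f \<in> borel_measurable (noise L)"
  shows "(\<integral>\<^sup>+w. f w \<partial>noise L) =
    (\<integral>\<^sup>+e. \<integral>\<^sup>+u. \<integral>\<^sup>+w. f (case_nat (e, u) w) \<partial>noise L \<partial>unif01 \<partial>clock L)"
proof -
  interpret u: prob_space unif01 by (rule prob_space_unif01)
  interpret n: prob_space "noise L" by (rule prob_space_noise[OF L])
  interpret m: prob_space "step_noise L" by (rule prob_space_step_noise[OF L])
  interpret sequence_space "step_noise L" by unfold_locales
  have "noise L = distr (step_noise L \<Otimes>\<^sub>M noise L) (noise L) (\<lambda>(s, w). case_nat s w)"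
    using PiM_iter by (simp add: noise_def)
  then have "(\<integral>\<^sup>+w. f w \<partial>noise L) =
      (\<integral>\<^sup>+w. f w \<partial>distr (step_noise L \<Otimes>\<^sub>M noise L) (noise L) (\<lambda>(s, w). case_nat s w))"
    by simp
  also have "\<dots> = (\<integral>\<^sup>+(s, w). f (case_nat s w) \<partial>(step_noise L \<Otimes>\<^sub>M noise L))"
    by (subst nn_integral_distr) (auto simp: split_beta')
  also have "\<dots> = (\<integral>\<^sup>+s. \<integral>\<^sup>+w. f (case_nat s w) \<partial>noise L \<partial>step_noise L)"
    by (subst n.nn_integral_fst[symmetric]) auto
  also have "\<dots> = (\<integral>\<^sup>+e. \<integral>\<^sup>+u. \<integral>\<^sup>+w. f (case_nat (e, u) w) \<partial>noise L \<partial>unif01 \<partial>clock L)"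
    unfolding step_noise_def by (subst u.nn_integral_fst[symmetric]) auto
  finally show ?thesis .
qed

text \<open>
  Exactly \<open>n\<close> holding times are completed by time \<open>t\<close>. The recursion peels off the first holding time
  instead of comparing \<open>t\<close> with partial sums, so that inductions on \<open>n\<close> condition on the first coordinate
  of the noise only.
\<close>

primrec jump_count :: "nat \<Rightarrow> real \<Rightarrow> (nat \<Rightarrow> real \<times> real) \<Rightarrow> bool" where
  "jump_count 0 t w \<longleftrightarrow> t < fst (w 0)"
| "jump_count (Suc n) t w \<longleftrightarrow> fst (w 0) \<le> t \<and> jump_count n (t - fst (w 0)) (tail w)"

text \<open>
  The noise as seen from time \<open>t\<close>, when \<open>n\<close> holding times are completed: these are dropped, and the
  current one is replaced by what is left of it.
\<close>

primrec restart :: "nat \<Rightarrow> real \<Rightarrow> (nat \<Rightarrow> real \<times> real) \<Rightarrow> nat \<Rightarrow> real \<times> real" where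
  "restart 0 t w = case_nat (fst (w 0) - t, snd (w 0)) (tail w)"
| "restart (Suc n) t w = restart n (t - fst (w 0)) (tail w)"

primrec chain :: "('s::countable \<Rightarrow> 's pmf) \<Rightarrow> nat \<Rightarrow> 's \<Rightarrow> (nat \<Rightarrow> real \<times> real) \<Rightarrow> 's" where
  "chain J 0 s w = s"
| "chain J (Suc n) s w = chain J n (quantile (J s) to_nat (snd (w 0))) (tail w)"

lemma jump_count_measurable2: "Measurable.pred (borel \<Otimes>\<^sub>M noise L) (\<lambda>(t, w). jump_count n t w)"
proof (induction n)
  case 0
  then show ?case by simp
next
  case (Suc n)
  note [measurable] = Suc
  have "(\<lambda>(t, w). jump_count n (t - fst (w 0)) (tail w)) =
      (\<lambda>p. (\<lambda>(t, w). jump_count n t w) (fst p - fst (snd p 0), tail (snd p)))"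
    by auto
  then have [measurable]: "Measurable.pred (borel \<Otimes>\<^sub>M noise L) (\<lambda>(t, w). jump_count n (t - fst (w 0)) (tail w))"
    by (simp only:) measurable
  show ?case by (simp add: split_beta')
qed

lemma jump_count_measurable [measurable (raw)]:
  assumes [measurable]: "f \<in> borel_measurable M" "g \<in> measurable M (noise L)"
  shows "Measurable.pred M (\<lambda>x. jump_count n (f x) (g x))"
  using measurable_compose[of "\<lambda>x. (f x, g x)", OF _ jump_count_measurable2[where L=L and n=n]] by simp

lemma restart_measurable2: "(\<lambda>(t, w). restart n t w) \<in> measurable (borel \<Otimes>\<^sub>M noise L) (noise L)"
proof (induction n)
  case 0
  then show ?case by simp
next
  case (Suc n)
  have "(\<lambda>p. (\<lambda>(t, w). restart n t w) (fst p - fst (snd p 0), tail (snd p)))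
      \<in> measurable (borel \<Otimes>\<^sub>M noise L) (noise L)"
    by (rule measurable_compose[OF _ Suc]) measurable
  then show ?case by (simp add: split_beta')
qed

lemma restart_measurable [measurable (raw)]:
  assumes [measurable]: "f \<in> borel_measurable M" "g \<in> measurable M (noise L)"
  shows "(\<lambda>x. restart n (f x) (g x)) \<in> measurable M (noise L)"
  using measurable_compose[of "\<lambda>x. (f x, g x)", OF _ restart_measurable2[where L=L and n=n]] by simp

lemma chain_measurable0: "chain J n s \<in> measurable (noise L) (count_space UNIV)"
proof (induction n arbitrary: s)
  case 0
  then show ?case by simp
next
  case (Suc n)
  have [measurable]: "(\<lambda>w. quantile (J s) to_nat (snd (w 0))) \<in> measurable (noise L) (count_space UNIV)"
    by (rule measurable_compose[OF _ quantile_measurable]) auto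
  have "(\<lambda>w. chain J n s' (tail w)) \<in> measurable (noise L) (count_space UNIV)" for s'
    using Suc by measurable
  then show ?case
    by (auto simp: chain.simps[abs_def] intro: measurable_compose_countable)
qed

lemma chain_measurable [measurable (raw)]:
  assumes f: "f \<in> measurable M (count_space UNIV)" and g: "g \<in> measurable M (noise L)"
  shows "(\<lambda>x. chain J n (f x) (g x)) \<in> measurable M (count_space UNIV)"
  by (rule measurable_compose_countable[OF measurable_compose[OF g chain_measurable0] f])

text \<open>
  The core of the construction: the number of jumps, the current state and the noise to come are
  jointly distributed as a Poisson number, the corresponding iterate of the kernel, and fresh noise
  that is independent of both. The proof conditions on the first holding time \<open>e\<close>. If \<open>t < e\<close>, nothing has
  happened and the remainder \<open>e - t\<close> is a fresh holding time by lack of memory. Otherwise the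
  induction hypothesis applies to the tail of the noise with time \<open>t - e\<close>, and integrating the Poisson
  weights over \<open>e\<close> raises the number of jumps by one.
\<close>

theorem uniformization_split:
  fixes J :: "'s::countable \<Rightarrow> 's pmf"
  assumes L: "0 < L" and t: "0 \<le> t" and B: "B \<in> sets (noise L)"
  shows "emeasure (noise L) {w. jump_count n t w \<and> chain J n s w = z \<and> restart n t w \<in> B} =
    ennreal (pmf (poisson (L * t)) n) * ennreal (pmf (kernel_iterate J n s) z) * emeasure (noise L) B"
  using t
proof (induction n arbitrary: t s)
  case 0
  interpret u: prob_space unif01 by (rule prob_space_unif01)
  interpret n: prob_space "noise L" by (rule prob_space_noise[OF L])
  note [measurable] = B
  define G where "G e = (\<integral>\<^sup>+u. \<integral>\<^sup>+w. indicator B (case_nat (e, u) w) \<partial>noise L \<partial>unif01)" for e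
  have G[measurable]: "G \<in> borel_measurable borel"
    unfolding G_def[abs_def] by measurable
  have "emeasure (noise L) {w. jump_count 0 t w \<and> chain J 0 s w = z \<and> restart 0 t w \<in> B} =
      (\<integral>\<^sup>+w. indicator {t<..} (fst (w 0)) * (indicator {z} s * indicator B (restart 0 t w)) \<partial>noise L)"
  proof (subst nn_integral_indicator[symmetric])
    have "{w \<in> space (noise L). jump_count 0 t w \<and> chain J 0 s w = z \<and> restart 0 t w \<in> B} \<in> sets (noise L)"
      by measurable
    then show "{w. jump_count 0 t w \<and> chain J 0 s w = z \<and> restart 0 t w \<in> B} \<in> sets (noise L)"
      by simp
  qed (auto intro!: nn_integral_cong split: split_indicator)
  also have "\<dots> = (\<integral>\<^sup>+e. indicator {t<..} e * (indicator {z} s * G (e - t)) \<partial>clock L)"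
    by (subst nn_integral_noise_iter[OF L]) (auto simp: nn_integral_cmult G_def)
  also have "\<dots> = ennreal (exp (- L * t)) * (\<integral>\<^sup>+e. indicator {z} s * G e \<partial>clock L)"
    by (subst clock_memoryless[OF _ L 0, symmetric]) auto
  also have "\<dots> = ennreal (exp (- L * t)) * (indicator {z} s * emeasure (noise L) B)"
  proof -
    have "emeasure (noise L) B = (\<integral>\<^sup>+w. indicator B w \<partial>noise L)"
      using B by simp
    also have "\<dots> = (\<integral>\<^sup>+e. G e \<partial>clock L)"
      unfolding G_def by (rule nn_integral_noise_iter[OF L]) simp
    finally show ?thesis by (simp add: nn_integral_cmult)
  qed
  finally show ?case
    using L 0 by (auto simp: pmf_poisson indicator_def mult.assoc)
next
  case (Suc n)
  interpret u: prob_space unif01 by (rule prob_space_unif01)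
  interpret n: prob_space "noise L" by (rule prob_space_noise[OF L])
  note [measurable] = B
  let ?q = "quantile (J s) to_nat"
  let ?A = "\<lambda>e u w. jump_count n (t - e) w \<and> chain J n (?q u) w = z \<and> restart n (t - e) w \<in> B"
  have [measurable]: "?q \<in> measurable borel (count_space UNIV)"
    by (rule quantile_measurable) simp
  have "emeasure (noise L) {w. jump_count (Suc n) t w \<and> chain J (Suc n) s w = z \<and> restart (Suc n) t w \<in> B} =
      (\<integral>\<^sup>+w. indicator {..t} (fst (w 0)) * indicator {w. ?A (fst (w 0)) (snd (w 0)) (tail w)} w \<partial>noise L)"
  proof (subst nn_integral_indicator[symmetric])
    have "{w \<in> space (noise L). jump_count (Suc n) t w \<and> chain J (Suc n) s w = z \<and> restart (Suc n) t w \<in> B}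
        \<in> sets (noise L)"
      by measurable
    then show "{w. jump_count (Suc n) t w \<and> chain J (Suc n) s w = z \<and> restart (Suc n) t w \<in> B} \<in> sets (noise L)"
      by simp
  qed (auto intro!: nn_integral_cong split: split_indicator)
  also have "\<dots> = (\<integral>\<^sup>+e. \<integral>\<^sup>+u. \<integral>\<^sup>+w. indicator {..t} e * indicator {w. ?A e u w} w \<partial>noise L \<partial>unif01 \<partial>clock L)"
    by (subst nn_integral_noise_iter[OF L])
       (auto intro!: nn_integral_cong simp: indicator_def)
  also have "\<dots> = (\<integral>\<^sup>+e. \<integral>\<^sup>+u. indicator {0..t} e * ennreal (pmf (poisson (L * (t - e))) n) *
      (ennreal (pmf (kernel_iterate J n (?q u)) z) * emeasure (noise L) B) \<partial>unif01 \<partial>clock L)"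
  proof (rule nn_integral_cong_AE)
    have "AE e in clock L. 0 \<le> e"
      unfolding clock_def by (subst AE_density) (auto simp: exponential_density_def)
    then show "AE e in clock L. (\<integral>\<^sup>+u. \<integral>\<^sup>+w. indicator {..t} e * indicator {w. ?A e u w} w \<partial>noise L \<partial>unif01) =
      (\<integral>\<^sup>+u. indicator {0..t} e * ennreal (pmf (poisson (L * (t - e))) n) *
      (ennreal (pmf (kernel_iterate J n (?q u)) z) * emeasure (noise L) B) \<partial>unif01)"
    proof eventually_elim
      case (elim e)
      have "(\<integral>\<^sup>+w. indicator {..t} e * indicator {w. ?A e u w} w \<partial>noise L) =
          indicator {0..t} e * ennreal (pmf (poisson (L * (t - e))) n) *
      (ennreal (pmf (kernel_iterate J n (?q u)) z) * emeasure (noise L) B)" for u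
      proof (cases "e \<le> t")
        case True
        have "{w \<in> space (noise L). ?A e u w} \<in> sets (noise L)" by measurable
        then have "{w. ?A e u w} \<in> sets (noise L)" by simp
        then show ?thesis
          using True elim Suc.IH[of "t - e" "?q u"] by (simp add: mult.assoc)
      qed auto
      then show ?case by simp
    qed
  qed
  also have "\<dots> = (\<integral>\<^sup>+e. indicator {0..t} e * ennreal (pmf (poisson (L * (t - e))) n) *
      ((\<integral>\<^sup>+u. ennreal (pmf (kernel_iterate J n (?q u)) z) \<partial>unif01) * emeasure (noise L) B) \<partial>clock L)"
    by (simp add: nn_integral_cmult nn_integral_multc)
  also have "\<dots> = (\<integral>\<^sup>+e. indicator {0..t} e * ennreal (pmf (poisson (L * (t - e))) n) \<partial>clock L) *
      ((\<integral>\<^sup>+u. ennreal (pmf (kernel_iterate J n (?q u)) z) \<partial>unif01) * emeasure (noise L) B)"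
  proof (rule nn_integral_multc)
    have "(\<lambda>e. indicator {0..t} e * ennreal (pmf (poisson (L * (t - e))) n)) =
        (\<lambda>e. indicator {0..t} e * ennreal ((L * (t - e)) ^ n / fact n * exp (- (L * (t - e)))))"
      using L by (intro ext) (auto simp: pmf_poisson split: split_indicator)
    then show "(\<lambda>e. indicator {0..t} e * ennreal (pmf (poisson (L * (t - e))) n)) \<in> borel_measurable (clock L)"
      by simp
  qed
  also have "(\<integral>\<^sup>+e. indicator {0..t} e * ennreal (pmf (poisson (L * (t - e))) n) \<partial>clock L) =
      ennreal (pmf (poisson (L * t)) (Suc n))"
    by (rule clock_poisson_step[OF L Suc.prems])
  also have "(\<integral>\<^sup>+u. ennreal (pmf (kernel_iterate J n (?q u)) z) \<partial>unif01) =
      (\<integral>\<^sup>+s'. ennreal (pmf (kernel_iterate J n s') z) \<partial>measure_pmf (J s))"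
    by (subst distr_quantile[symmetric, of to_nat]) (auto simp: nn_integral_distr)
  also have "\<dots> = ennreal (pmf (kernel_iterate J (Suc n) s) z)"
    by (simp add: ennreal_pmf_bind)
  finally show ?case by (simp add: mult.assoc)
qed

section \<open>Restarting at a fixed time\<close>

lemma jump_count_unique: "jump_count n t w \<Longrightarrow> jump_count m t w \<Longrightarrow> n = m"
proof (induction n arbitrary: m t w)
  case 0
  then show ?case by (cases m) auto
next
  case (Suc n)
  then show ?case by (cases m) auto
qed

text \<open>
  Counting jumps up to time \<open>t + r\<close> is counting up to \<open>t\<close> and then counting for a time \<open>r\<close> with the noise
  seen from \<open>t\<close>. With the analogous fact for the chain, it makes the process restart at time \<open>t\<close>.
\<close>

lemma jump_count_add:
  assumes "jump_count n t w" "0 \<le> r"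
  shows "jump_count (n + m) (t + r) w \<longleftrightarrow> jump_count m r (restart n t w)"
  using assms
proof (induction n arbitrary: t w)
  case 0
  then show ?case by (cases m) (auto simp: algebra_simps)
next
  case (Suc n)
  have eq: "t + r - fst (w 0) = (t - fst (w 0)) + r" by simp
  show ?case using Suc.IH[of "t - fst (w 0)" "tail w"] Suc.prems by (auto simp: eq)
qed

lemma chain_add: "chain J (n + m) s w = chain J m (chain J n s w) (restart n t w)"
proof (induction n arbitrary: s t w)
  case 0
  then show ?case by (cases m) auto
next
  case (Suc n)
  then show ?case by simp
qed

lemma jump_count_mono:
  assumes "jump_count n t w" "t' \<le> t"
  obtains m where "m \<le> n" "jump_count m t' w"
proof -
  have "\<exists>m\<le>n. jump_count m t' w"
    using assms
  proof (induction n arbitrary: t t' w)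
    case 0
    then show ?case by auto
  next
    case (Suc n)
    show ?case
    proof (cases "t' < fst (w 0)")
      case True
      then show ?thesis by (intro exI[of _ 0]) auto
    next
      case False
      with Suc.IH[of "t - fst (w 0)" "tail w" "t' - fst (w 0)"] Suc.prems
      obtain m where "m \<le> n" "jump_count m (t' - fst (w 0)) (tail w)" by auto
      with False show ?thesis by (intro exI[of _ "Suc m"]) auto
    qed
  qed
  then show ?thesis using that by auto
qed

lemma jump_count_at_right:
  assumes "jump_count n t w"
  shows "\<forall>\<^sub>F u in at_right t. jump_count n u w"
proof -
  have "\<exists>\<epsilon>>0. \<forall>u. t \<le> u \<and> u < t + \<epsilon> \<longrightarrow> jump_count n u w"
    using assms
  proof (induction n arbitrary: t w)
    case 0
    then show ?case by (intro exI[of _ "fst (w 0) - t"]) auto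
  next
    case (Suc n)
    then obtain \<epsilon> where \<epsilon>: "0 < \<epsilon>"
        "\<And>u. t - fst (w 0) \<le> u \<Longrightarrow> u < t - fst (w 0) + \<epsilon> \<Longrightarrow> jump_count n u (tail w)"
      by force
    with Suc.prems show ?case by (intro exI[of _ \<epsilon>]) auto
  qed
  then obtain \<epsilon> where "0 < \<epsilon>" "\<And>u. t \<le> u \<Longrightarrow> u < t + \<epsilon> \<Longrightarrow> jump_count n u w" by auto
  then show ?thesis by (auto simp: eventually_at_right_field intro!: exI[of _ "t + \<epsilon>"])
qed

lemma jump_count_at_left:
  assumes "jump_count n t w"
  obtains m where "\<forall>\<^sub>F u in at_left t. jump_count m u w"
proof -
  have "\<exists>m. \<exists>\<epsilon>>0. \<forall>u. t - \<epsilon> < u \<and> u < t \<longrightarrow> jump_count m u w"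
    using assms
  proof (induction n arbitrary: t w)
    case 0
    then show ?case by (intro exI[of _ 0] exI[of _ 1]) auto
  next
    case (Suc n)
    show ?case
    proof (cases "fst (w 0) = t")
      case True
      then show ?thesis by (intro exI[of _ 0] exI[of _ 1]) auto
    next
      case False
      with Suc.prems have less: "fst (w 0) < t" by simp
      from Suc.IH[of "t - fst (w 0)" "tail w"] Suc.prems
      obtain m \<epsilon> where \<epsilon>: "0 < \<epsilon>"
          "\<And>u. t - fst (w 0) - \<epsilon> < u \<Longrightarrow> u < t - fst (w 0) \<Longrightarrow> jump_count m u (tail w)"
        by auto
      show ?thesis
        by (rule exI[of _ "Suc m"], rule exI[of _ "min \<epsilon> (t - fst (w 0))"]) (use \<epsilon> less in auto)
    qed
  qed
  then obtain m \<epsilon> where "0 < \<epsilon>" "\<And>u. t - \<epsilon> < u \<Longrightarrow> u < t \<Longrightarrow> jump_count m u w" by auto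
  then show ?thesis
    by (intro that[of m]) (auto simp: eventually_at_left_field intro!: exI[of _ "t - \<epsilon>"])
qed

definition njumps :: "real \<Rightarrow> (nat \<Rightarrow> real \<times> real) \<Rightarrow> nat" where
  "njumps t w = (LEAST n. jump_count n t w)"

definition state_at :: "('s::countable \<Rightarrow> 's pmf) \<Rightarrow> real \<Rightarrow> 's \<Rightarrow> (nat \<Rightarrow> real \<times> real) \<Rightarrow> 's" where
  "state_at J t s w = chain J (njumps t w) s w"

definition restarted_noise :: "real \<Rightarrow> (nat \<Rightarrow> real \<times> real) \<Rightarrow> nat \<Rightarrow> real \<times> real" where
  "restarted_noise t w = restart (njumps t w) t w"

text \<open>
  The noise describes a process up to time \<open>t\<close>: not infinitely many jumps have accumulated before.
\<close>

definition alive :: "real \<Rightarrow> (nat \<Rightarrow> real \<times> real) \<Rightarrow> bool" where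
  "alive t w \<longleftrightarrow> (\<exists>n. jump_count n t w)"

lemma njumps_eq: "jump_count n t w \<Longrightarrow> njumps t w = n"
  unfolding njumps_def by (rule Least_equality) (auto dest: jump_count_unique)

lemma alive_restart:
  assumes "alive t w" "0 \<le> r"
  shows "alive (t + r) w \<longleftrightarrow> alive r (restarted_noise t w)"
proof -
  from assms obtain n where n: "jump_count n t w" by (auto simp: alive_def)
  have "\<exists>m. m' = n + m" if m': "jump_count m' (t + r) w" for m'
  proof -
    obtain k where "k \<le> m'" "jump_count k t w" using jump_count_mono[OF m', of t] assms(2) by auto
    with n have "n \<le> m'" by (auto dest: jump_count_unique)
    then show ?thesis by (auto simp: le_iff_add)
  qed
  then show ?thesis
    using jump_count_add[OF n assms(2)] by (auto simp: alive_def restarted_noise_def njumps_eq[OF n]; blast)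
qed

lemma state_at_restart:
  assumes "alive t w" "0 \<le> r" "alive (t + r) w"
  shows "state_at J (t + r) s w = state_at J r (state_at J t s w) (restarted_noise t w)"
proof -
  from assms obtain n where n: "jump_count n t w" by (auto simp: alive_def)
  from assms obtain m where m: "jump_count m r (restarted_noise t w)"
    using alive_restart[OF assms(1,2)] by (auto simp: alive_def)
  then have "jump_count (n + m) (t + r) w"
    using jump_count_add[OF n assms(2)] by (simp add: restarted_noise_def njumps_eq[OF n])
  with m n show ?thesis
    by (simp add: state_at_def njumps_eq restarted_noise_def chain_add)
qed

lemma njumps_measurable [measurable]: "njumps t \<in> measurable (noise L) (count_space UNIV)"
  unfolding njumps_def[abs_def] by measurable

lemma state_at_measurable [measurable]: "state_at J t s \<in> measurable (noise L) (count_space UNIV)"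
proof -
  have "(\<lambda>w. chain J n s w) \<in> measurable (noise L) (count_space UNIV)" for n by measurable
  from measurable_compose_countable[OF this njumps_measurable] show ?thesis
    unfolding state_at_def[abs_def] .
qed

lemma restarted_noise_measurable [measurable]: "restarted_noise t \<in> measurable (noise L) (noise L)"
proof -
  have "(\<lambda>w. restart n t w) \<in> measurable (noise L) (noise L)" for n by measurable
  from measurable_compose_countable[OF this njumps_measurable] show ?thesis
    unfolding restarted_noise_def[abs_def] .
qed

lemma alive_measurable [measurable]: "Measurable.pred (noise L) (alive t)"
  unfolding alive_def[abs_def] by measurable

lemma pred_noise_sets: "Measurable.pred (noise L) P \<Longrightarrow> {w. P w} \<in> sets (noise L)"
  by (drule predE) simp

lemma noise_UNIV_sets: "UNIV \<in> sets (noise L)"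
  using sets.top[of "noise L"] by simp

lemma emeasure_noise_UNIV: "0 < L \<Longrightarrow> emeasure (noise L) UNIV = 1"
  using prob_space.emeasure_space_1[OF prob_space_noise, of L] by simp

section \<open>Markov property and finite-dimensional distributions\<close>

text \<open>
  The law at time \<open>t\<close> of a chain with kernel \<open>P\<close> that jumps at the times of a Poisson process of rate \<open>L\<close>,
  in other words the semigroup \<open>exp (t L (P - 1))\<close>.
\<close>

definition uniformized_kernel :: "real \<Rightarrow> ('x \<Rightarrow> 'x pmf) \<Rightarrow> real \<Rightarrow> 'x \<Rightarrow> 'x pmf" where
  "uniformized_kernel L P t x = bind_pmf (poisson (L * t)) (\<lambda>n. kernel_iterate P n x)"

lemma markov_at_time_single:
  fixes J :: "'s::countable \<Rightarrow> 's pmf"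
  assumes L: "0 < L" and t: "0 \<le> t" and B[measurable]: "B \<in> sets (noise L)"
  shows "emeasure (noise L) {w. alive t w \<and> state_at J t s w = z \<and> restarted_noise t w \<in> B} =
    ennreal (pmf (uniformized_kernel L J t s) z) * emeasure (noise L) B"
proof -
  let ?A = "\<lambda>n. {w. jump_count n t w \<and> chain J n s w = z \<and> restart n t w \<in> B}"
  have A: "?A n \<in> sets (noise L)" for n
    by (rule pred_noise_sets) measurable
  have "{w. alive t w \<and> state_at J t s w = z \<and> restarted_noise t w \<in> B} = (\<Union>n. ?A n)"
    by (auto simp: alive_def state_at_def restarted_noise_def njumps_eq)
  then have "emeasure (noise L) {w. alive t w \<and> state_at J t s w = z \<and> restarted_noise t w \<in> B} =
      (\<integral>\<^sup>+n. emeasure (noise L) (?A n) \<partial>count_space UNIV)"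
    using A by (simp only:) (intro emeasure_UN_countable, auto simp: disjoint_family_on_def dest: jump_count_unique)
  also have "\<dots> = (\<integral>\<^sup>+n. ennreal (pmf (poisson (L * t)) n) * ennreal (pmf (kernel_iterate J n s) z) *
      emeasure (noise L) B \<partial>count_space UNIV)"
    by (intro nn_integral_cong uniformization_split[OF L t B])
  also have "\<dots> = (\<integral>\<^sup>+n. ennreal (pmf (kernel_iterate J n s) z) \<partial>measure_pmf (poisson (L * t))) * emeasure (noise L) B"
    by (subst nn_integral_multc) (auto simp: nn_integral_measure_pmf)
  also have "(\<integral>\<^sup>+n. ennreal (pmf (kernel_iterate J n s) z) \<partial>measure_pmf (poisson (L * t))) =
      ennreal (pmf (uniformized_kernel L J t s) z)"
    by (simp add: uniformized_kernel_def ennreal_pmf_bind)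
  finally show ?thesis .
qed

text \<open>
  The event \<open>B z\<close> for the future may depend on the present state \<open>z\<close>, while its probability is the same for
  all \<open>z \<in> C\<close>. This is the situation of a process that is observed through a function of the state
  only, where \<open>C\<close> is a fibre of that function.
\<close>

lemma markov_at_time:
  fixes J :: "'s::countable \<Rightarrow> 's pmf"
  assumes L: "0 < L" and t: "0 \<le> t" and B: "\<And>z. B z \<in> sets (noise L)"
    and c: "\<And>z. z \<in> C \<Longrightarrow> emeasure (noise L) (B z) = c"
  shows "emeasure (noise L) {w. alive t w \<and> state_at J t s w \<in> C \<and> restarted_noise t w \<in> B (state_at J t s w)} =
    emeasure (measure_pmf (uniformized_kernel L J t s)) C * c"
proof -
  note B[measurable]
  let ?A = "\<lambda>z. {w. alive t w \<and> state_at J t s w = z \<and> restarted_noise t w \<in> B z}"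
  have A: "?A z \<in> sets (noise L)" for z
    by (rule pred_noise_sets) measurable
  have "{w. alive t w \<and> state_at J t s w \<in> C \<and> restarted_noise t w \<in> B (state_at J t s w)} = (\<Union>z\<in>C. ?A z)"
    by auto
  then have "emeasure (noise L) {w. alive t w \<and> state_at J t s w \<in> C \<and> restarted_noise t w \<in> B (state_at J t s w)} =
      (\<integral>\<^sup>+z. emeasure (noise L) (?A z) \<partial>count_space C)"
    using A by (simp only:) (intro emeasure_UN_countable, auto simp: disjoint_family_on_def)
  also have "\<dots> = (\<integral>\<^sup>+z. ennreal (pmf (uniformized_kernel L J t s) z) * c \<partial>count_space C)"
    by (intro nn_integral_cong) (simp add: markov_at_time_single[OF L t B] c)
  also have "\<dots> = (\<integral>\<^sup>+z. ennreal (pmf (uniformized_kernel L J t s) z) \<partial>count_space C) * c"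
    by (rule nn_integral_multc) auto
  also have "(\<integral>\<^sup>+z. ennreal (pmf (uniformized_kernel L J t s) z) \<partial>count_space C) = emeasure (uniformized_kernel L J t s) C"
    by (rule nn_integral_pmf)
  finally show ?thesis .
qed

definition alive_forever :: "(nat \<Rightarrow> real \<times> real) \<Rightarrow> bool" where
  "alive_forever w \<longleftrightarrow> (\<forall>t\<ge>0. alive t w)"

lemma alive_forever_iff: "alive_forever w \<longleftrightarrow> (\<forall>k. alive (real k) w)"
proof
  assume *: "\<forall>k. alive (real k) w"
  show "alive_forever w"
    unfolding alive_forever_def
  proof (intro allI impI)
    fix t :: real
    obtain k where "t \<le> real k" using real_arch_simple by blast
    with * show "alive t w" by (auto simp: alive_def elim: jump_count_mono)
  qed
qed (simp add: alive_forever_def)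

lemma alive_forever_measurable [measurable]: "Measurable.pred (noise L) alive_forever"
  unfolding alive_forever_iff[abs_def] by measurable

text \<open>
  Explosions are excluded by the previous lemmas themselves: the Poisson weights of the numbers of
  jumps sum to one. The chain on a single state, for which nothing but the jumps is recorded, suffices.
\<close>

lemma AE_alive:
  assumes L: "0 < L"
  shows "AE w in noise L. alive_forever w"
proof -
  interpret prob_space "noise L" by (rule prob_space_noise[OF L])
  have "AE w in noise L. alive (real k) w" for k
  proof (rule AE_I_eq_1)
    have "emeasure (noise L) {w. alive (real k) w \<and> state_at return_pmf (real k) () w \<in> UNIV \<and>
        restarted_noise (real k) w \<in> UNIV} = 1"
      using measure_pmf.emeasure_space_1[of "uniformized_kernel L return_pmf (real k) ()"]
      by (subst markov_at_time[OF L, where c=1])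
         (simp_all add: noise_UNIV_sets emeasure_noise_UNIV[OF L])
    then show "emeasure (noise L) {w \<in> space (noise L). alive (real k) w} = 1" by simp
  qed (simp add: pred_noise_sets)
  then show ?thesis by (simp add: alive_forever_iff AE_all_countable)
qed

lemma kernel_iterate_lump:
  assumes "\<And>s. map_pmf h (J s) = P (h s)"
  shows "map_pmf h (kernel_iterate J n s) = kernel_iterate P n (h s)"
proof (induction n arbitrary: s)
  case (Suc n)
  then show ?case by (simp add: map_bind_pmf assms[symmetric] bind_map_pmf)
qed simp

lemma uniformized_kernel_lump:
  assumes "\<And>s. map_pmf h (J s) = P (h s)"
  shows "map_pmf h (uniformized_kernel L J t s) = uniformized_kernel L P t (h s)"
  by (simp add: uniformized_kernel_def map_bind_pmf kernel_iterate_lump[of h J P, OF assms])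

text \<open>
  If the distribution of the next value of \<open>h\<close> depends on the state \<open>s\<close> only through \<open>h s\<close>, then the
  observed process is Markov with its own kernel. The induction splits off the earliest time, where the
  process restarts: by the induction hypothesis the probability of the prescribed future is the same for
  all states in the fibre over \<open>x 0\<close>. Splitting off the latest time instead would need the
  conditional law of the whole state given the observed past.
\<close>

theorem finite_dimensional_law:
  fixes J :: "'s::countable \<Rightarrow> 's pmf" and h :: "'s \<Rightarrow> 'x"
  assumes L: "0 < L" and lump: "\<And>s. map_pmf h (J s) = P (h s)"
    and "0 \<le> t 0" and "\<And>i. i < k \<Longrightarrow> t i \<le> t (Suc i)"
  shows "emeasure (noise L) {w. \<forall>i\<le>k. alive (t i) w \<and> h (state_at J (t i) s w) = x i} =
    ennreal (pmf (uniformized_kernel L P (t 0) (h s)) (x 0) * (\<Prod>i<k. pmf (uniformized_kernel L P (t (Suc i) - t i) (x i)) (x (Suc i))))"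
  using assms(3,4)
proof (induction k arbitrary: t x s)
  case 0
  have "emeasure (noise L) {w. alive (t 0) w \<and> state_at J (t 0) s w \<in> h -` {x 0} \<and> restarted_noise (t 0) w \<in> UNIV} =
      emeasure (measure_pmf (uniformized_kernel L J (t 0) s)) (h -` {x 0}) * 1"
    by (rule markov_at_time[OF L 0(1)]) (simp_all add: noise_UNIV_sets emeasure_noise_UNIV[OF L])
  also have "emeasure (measure_pmf (uniformized_kernel L J (t 0) s)) (h -` {x 0}) = ennreal (pmf (uniformized_kernel L P (t 0) (h s)) (x 0))"
    by (simp add: uniformized_kernel_lump[of h J P, OF lump, symmetric] pmf_map measure_pmf.emeasure_eq_measure)
  finally show ?case by simp
next
  case (Suc k)
  define t' where "t' i = t (Suc i) - t 0" for i
  define B where "B z = {w. \<forall>i\<le>k. alive (t' i) w \<and> h (state_at J (t' i) z w) = x (Suc i)}" for z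
  have t0: "t 0 \<le> t i" if "i \<le> Suc k" for i
    using that
  proof (induction i)
    case (Suc i)
    then show ?case using Suc.prems Suc.IH \<open>\<And>i. i < Suc k \<Longrightarrow> t i \<le> t (Suc i)\<close>[of i] by auto
  qed simp
  let ?r = "\<Prod>i<k. pmf (uniformized_kernel L P (t (Suc (Suc i)) - t (Suc i)) (x (Suc i))) (x (Suc (Suc i)))"
  let ?c = "ennreal (pmf (uniformized_kernel L P (t (Suc 0) - t 0) (x 0)) (x (Suc 0)) * ?r)"
  have c: "emeasure (noise L) (B z) = ?c" if z: "z \<in> h -` {x 0}" for z
  proof -
    have "emeasure (noise L) (B z) =
      ennreal (pmf (uniformized_kernel L P (t' 0) (h z)) (x (Suc 0)) *
        (\<Prod>i<k. pmf (uniformized_kernel L P (t' (Suc i) - t' i) (x (Suc i))) (x (Suc (Suc i)))))"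
      unfolding B_def
      by (rule Suc.IH[of t' z "\<lambda>i. x (Suc i)"]) (use Suc.prems(2) t0[of 1] in \<open>auto simp: t'_def\<close>)
    then show ?thesis using z by (simp add: t'_def)
  qed
  have Bm: "B z \<in> sets (noise L)" for z
    unfolding B_def
  proof (rule pred_noise_sets)
    have "Measurable.pred (noise L) (\<lambda>w. h (state_at J u z w) = y)" for u y
      by (rule measurable_compose[OF state_at_measurable, where g="\<lambda>s. h s = y"]) simp
    then show "Measurable.pred (noise L) (\<lambda>w. \<forall>i\<le>k. alive (t' i) w \<and> h (state_at J (t' i) z w) = x (Suc i))"
      by measurable
  qed
  have "{w. \<forall>i\<le>Suc k. alive (t i) w \<and> h (state_at J (t i) s w) = x i} =
      {w. alive (t 0) w \<and> state_at J (t 0) s w \<in> h -` {x 0} \<and> restarted_noise (t 0) w \<in> B (state_at J (t 0) s w)}"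
  proof -
    have "(\<forall>i\<le>Suc k. alive (t i) w \<and> h (state_at J (t i) s w) = x i) \<longleftrightarrow>
      alive (t 0) w \<and> h (state_at J (t 0) s w) = x 0 \<and> restarted_noise (t 0) w \<in> B (state_at J (t 0) s w)" for w
    proof -
      have split: "(\<forall>i\<le>Suc k. Q i) \<longleftrightarrow> Q 0 \<and> (\<forall>i\<le>k. Q (Suc i))" for Q
        by (metis Suc_le_mono le0 not0_implies_Suc)
      have step: "alive (t (Suc i)) w \<and> h (state_at J (t (Suc i)) s w) = x (Suc i) \<longleftrightarrow>
          alive (t' i) (restarted_noise (t 0) w) \<and>
          h (state_at J (t' i) (state_at J (t 0) s w) (restarted_noise (t 0) w)) = x (Suc i)"
        if "i \<le> k" "alive (t 0) w" for i
        using alive_restart[OF that(2), of "t' i"] state_at_restart[OF that(2), of "t' i" J s] t0[of "Suc i"] that(1)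
        by (auto simp: t'_def)
      show ?thesis
        unfolding split B_def using step by auto
    qed
    then show ?thesis by auto
  qed
  then have "emeasure (noise L) {w. \<forall>i\<le>Suc k. alive (t i) w \<and> h (state_at J (t i) s w) = x i} =
      emeasure (measure_pmf (uniformized_kernel L J (t 0) s)) (h -` {x 0}) * ?c"
    by (simp only:) (rule markov_at_time[OF L Suc.prems(1) Bm c])
  also have "emeasure (measure_pmf (uniformized_kernel L J (t 0) s)) (h -` {x 0}) = ennreal (pmf (uniformized_kernel L P (t 0) (h s)) (x 0))"
    by (simp add: uniformized_kernel_lump[of h J P, OF lump, symmetric] pmf_map measure_pmf.emeasure_eq_measure)
  finally show ?case
    by (simp add: prod.lessThan_Suc_shift ennreal_mult'[symmetric] prod_nonneg mult.assoc del: prod.lessThan_Suc)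
qed

section \<open>Transition functions of uniformized chains\<close>

lemma kernel_iterate_add: "kernel_iterate P (n + m) x = bind_pmf (kernel_iterate P n x) (kernel_iterate P m)"
  by (induction n arbitrary: x) (auto simp: bind_return_pmf bind_assoc_pmf intro!: bind_pmf_cong)

lemma poisson_add:
  assumes "0 \<le> a" "0 \<le> b"
  shows "bind_pmf (poisson a) (\<lambda>n. map_pmf ((+) n) (poisson b)) = poisson (a + b)"
proof (rule pmf_eqI)
  fix k
  have m: "pmf (map_pmf ((+) n) (poisson b)) k = (if n \<le> k then pmf (poisson b) (k - n) else 0)" for n
  proof (cases "n \<le> k")
    case True
    then have "pmf (map_pmf ((+) n) (poisson b)) (n + (k - n)) = pmf (poisson b) (k - n)"
      by (intro pmf_map_inj') (auto simp: inj_def)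
    with True show ?thesis by simp
  next
    case False
    then show ?thesis by (auto intro!: pmf_map_outside)
  qed
  have "pmf (bind_pmf (poisson a) (\<lambda>n. map_pmf ((+) n) (poisson b))) k =
      (\<Sum>n\<le>k. pmf (poisson a) n * pmf (poisson b) (k - n))"
    unfolding pmf_bind m by (subst integral_measure_pmf[of "{..k}"]) (auto split: if_splits)
  also have "\<dots> = (\<Sum>n\<le>k. (real (k choose n) * a ^ n * b ^ (k - n)) * (exp (- (a + b)) / fact k))"
    using assms by (intro sum.cong refl) (simp add: pmf_poisson binomial_fact exp_add exp_minus exp_diff field_simps)
  also have "\<dots> = pmf (poisson (a + b)) k"
    using assms by (simp add: pmf_poisson binomial_ring sum_distrib_right sum_divide_distrib)
  finally show "pmf (bind_pmf (poisson a) (\<lambda>n. map_pmf ((+) n) (poisson b))) k = pmf (poisson (a + b)) k" .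
qed

lemma uniformized_kernel_0: "uniformized_kernel L P 0 x = return_pmf x"
  by (simp add: uniformized_kernel_def poisson_def bind_return_pmf)

lemma uniformized_kernel_add:
  assumes "0 < L" "0 \<le> s" "0 \<le> t"
  shows "uniformized_kernel L P (s + t) x = bind_pmf (uniformized_kernel L P s x) (uniformized_kernel L P t)"
proof -
  have "uniformized_kernel L P (s + t) x = bind_pmf (bind_pmf (poisson (L * s)) (\<lambda>n. map_pmf ((+) n) (poisson (L * t)))) (\<lambda>n. kernel_iterate P n x)"
    using assms by (subst poisson_add) (auto simp: uniformized_kernel_def distrib_left)
  also have "\<dots> = bind_pmf (poisson (L * s)) (\<lambda>n. bind_pmf (poisson (L * t)) (\<lambda>m. bind_pmf (kernel_iterate P n x) (kernel_iterate P m)))"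
    by (simp add: bind_assoc_pmf bind_map_pmf kernel_iterate_add)
  also have "\<dots> = bind_pmf (uniformized_kernel L P s x) (uniformized_kernel L P t)"
    unfolding uniformized_kernel_def bind_assoc_pmf by (subst bind_commute_pmf) (rule refl)
  finally show ?thesis .
qed

text \<open>
  To first order in \<open>h\<close> only the paths with at most one jump matter, and they give \<open>g\<close>. Two or more jumps
  contribute at most their Poisson probability \<open>1 - exp (- L h) (1 + L h)\<close>, which is \<open>o(h)\<close>.
\<close>

lemma pmf_uniformized_kernel_bounds:
  fixes P :: "'x \<Rightarrow> 'x pmf" and x y :: 'x
  assumes L: "0 < L" and h: "0 \<le> h"
  defines "g \<equiv> exp (- L * h) * (of_bool (x = y) + L * h * pmf (P x) y)"
  shows "g \<le> pmf (uniformized_kernel L P h x) y"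
    and "pmf (uniformized_kernel L P h x) y \<le> g + (1 - exp (- L * h) * (1 + L * h))"
proof -
  let ?M = "measure_pmf (poisson (L * h))"
  let ?f = "\<lambda>n. pmf (kernel_iterate P n x) y"
  let ?g = "\<lambda>n. of_bool (x = y) * indicator {0} n + pmf (P x) y * indicator {1} n :: real"
  let ?u = "\<lambda>n. ?g n + (1 - indicator {0} n - indicator {1} n)"
  have p: "measure ?M {0} = exp (- L * h)" "measure ?M {Suc 0} = exp (- L * h) * (L * h)"
    using L h by (auto simp: measure_pmf_single pmf_poisson)
  have I[simp]: "integrable ?M (indicator A :: nat \<Rightarrow> real)" for A
    by (auto simp: integrable_indicator_iff less_top[symmetric])
  have If: "integrable ?M ?f"
    by (rule measure_pmf.integrable_const_bound[where B=1]) (auto simp: pmf_le_1)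
  have g: "(\<integral>n. ?g n \<partial>?M) = g"
    by (simp add: p g_def algebra_simps)
  have u: "(\<integral>n. ?u n \<partial>?M) = g + (1 - exp (- L * h) * (1 + L * h))"
    by (simp add: p g_def algebra_simps)
  have f0: "?f 0 = of_bool (x = y)" and f1: "?f (Suc 0) = pmf (P x) y"
    using bind_return_pmf'[of "P x"] by (auto simp: kernel_iterate.simps(1)[abs_def])
  have f: "?g n \<le> ?f n \<and> ?f n \<le> ?u n" for n
    using f0 f1 pmf_le_1[of "kernel_iterate P n x" y] pmf_nonneg[of "kernel_iterate P n x" y]
    by (cases "n = 0"; cases "n = Suc 0") (auto simp del: kernel_iterate.simps)
  have K: "pmf (uniformized_kernel L P h x) y = (\<integral>n. ?f n \<partial>?M)"
    by (simp add: uniformized_kernel_def pmf_bind)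
  show "g \<le> pmf (uniformized_kernel L P h x) y"
    unfolding K g[symmetric] using f by (intro integral_mono If) auto
  show "pmf (uniformized_kernel L P h x) y \<le> g + (1 - exp (- L * h) * (1 + L * h))"
    unfolding K u[symmetric] using f by (intro integral_mono If) auto
qed

lemma infsum_pmf_compl: "(\<Sum>\<^sub>\<infinity>y\<in>-{x}. pmf p y) = 1 - pmf p x"
proof -
  have "(\<Sum>\<^sub>\<infinity>y\<in>-{x}. pmf p y) = measure (measure_pmf p) (-{x})"
    unfolding measure_pmf_conv_infsetsum by (rule infsetsum_infsum[symmetric]) (rule pmf_abs_summable)
  also have "\<dots> = 1 - pmf p x"
    using measure_pmf.prob_compl[of "{x}" p] by (simp add: Compl_eq_Diff_UNIV measure_pmf_single)
  finally show ?thesis .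
qed

text \<open>
  Only the off-diagonal rates are related to \<open>P\<close>: jumps of the chain from a state to itself are invisible,
  and the mass \<open>P x x\<close> adjusts the constant jump rate \<open>L\<close> to the exit rate of \<open>x\<close>.
\<close>

theorem transition_function_uniformized_kernel:
  fixes P :: "'x::countable \<Rightarrow> 'x pmf"
  assumes L: "0 < L" and q: "\<And>x y. x \<noteq> y \<Longrightarrow> q x y = L * pmf (P x) y"
  shows "transition_function q (uniformized_kernel L P)"
  unfolding transition_function_def
proof (intro conjI allI impI)
  have ev: "\<forall>\<^sub>F h in at_right (0::real). 0 < h" by (rule eventually_at_right_less)
  fix x y :: 'x
  show "uniformized_kernel L P 0 x = return_pmf x" by (rule uniformized_kernel_0)
  show "uniformized_kernel L P (s + t) x = bind_pmf (uniformized_kernel L P s x) (uniformized_kernel L P t)" if "0 \<le> s" "0 \<le> t" for s t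
    by (rule uniformized_kernel_add[OF L that])
  show "((\<lambda>h. pmf (uniformized_kernel L P h x) y / h) \<longlongrightarrow> q x y) (at_right 0)" if "x \<noteq> y"
  proof (rule tendsto_sandwich)
    let ?p = "pmf (P x) y"
    let ?l = "\<lambda>h. exp (- L * h) * (L * h * ?p)"
    show "\<forall>\<^sub>F h in at_right 0. ?l h / h \<le> pmf (uniformized_kernel L P h x) y / h"
      using ev by eventually_elim
        (use that pmf_uniformized_kernel_bounds(1)[OF L, where x=x and y=y and P=P] in \<open>intro divide_right_mono, auto\<close>)
    show "\<forall>\<^sub>F h in at_right 0. pmf (uniformized_kernel L P h x) y / h \<le> (?l h + (1 - exp (- L * h) * (1 + L * h))) / h"
      using ev by eventually_elim
        (use that pmf_uniformized_kernel_bounds(2)[OF L, where x=x and y=y and P=P] in \<open>auto intro!: divide_right_mono\<close>)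
    show "((\<lambda>h. ?l h / h) \<longlongrightarrow> q x y) (at_right 0)"
      unfolding q[OF that] using L by real_asymp
    show "((\<lambda>h. (?l h + (1 - exp (- L * h) * (1 + L * h))) / h) \<longlongrightarrow> q x y) (at_right 0)"
      unfolding q[OF that] using L by real_asymp
  qed
  have "(\<Sum>\<^sub>\<infinity>y\<in>-{x}. q x y) = (\<Sum>\<^sub>\<infinity>y\<in>-{x}. L * pmf (P x) y)"
    by (rule infsum_cong) (auto simp: q)
  then have s: "(\<Sum>\<^sub>\<infinity>y\<in>-{x}. q x y) = L - L * pmf (P x) x"
    by (simp add: infsum_cmult_right' infsum_pmf_compl right_diff_distrib)
  show "((\<lambda>h. (1 - pmf (uniformized_kernel L P h x) x) / h) \<longlongrightarrow> (\<Sum>\<^sub>\<infinity>y\<in>-{x}. q x y)) (at_right 0)"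
    unfolding s
  proof (rule tendsto_sandwich)
    let ?p = "pmf (P x) x"
    let ?l = "\<lambda>h. exp (- L * h) * (1 + L * h * ?p)"
    show "\<forall>\<^sub>F h in at_right 0. (1 - (?l h + (1 - exp (- L * h) * (1 + L * h)))) / h \<le> (1 - pmf (uniformized_kernel L P h x) x) / h"
      using ev
    proof eventually_elim
      case (elim h)
      then show ?case
        using pmf_uniformized_kernel_bounds(2)[OF L, where h=h and x=x and y=x and P=P]
        by (intro divide_right_mono) auto
    qed
    show "\<forall>\<^sub>F h in at_right 0. (1 - pmf (uniformized_kernel L P h x) x) / h \<le> (1 - ?l h) / h"
      using ev by eventually_elim
        (use pmf_uniformized_kernel_bounds(1)[OF L, where x=x and y=x and P=P] in \<open>auto intro!: divide_right_mono\<close>)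
    show "((\<lambda>h. (1 - (?l h + (1 - exp (- L * h) * (1 + L * h)))) / h) \<longlongrightarrow> L - L * ?p) (at_right 0)"
      using L by real_asymp
    show "((\<lambda>h. (1 - ?l h) / h) \<longlongrightarrow> L - L * ?p) (at_right 0)"
      using L by real_asymp
  qed
qed

section \<open>Jump processes on real sequences\<close>

definition driving_law :: "real \<Rightarrow> 's pmf \<Rightarrow> ('s \<times> (nat \<Rightarrow> real \<times> real)) measure" where
  "driving_law L \<rho> = measure_pmf \<rho> \<Otimes>\<^sub>M noise L"

lemma space_driving_law [simp]: "space (driving_law L \<rho>) = UNIV"
  by (simp add: driving_law_def space_pair_measure)

lemma prob_space_driving_law: "0 < L \<Longrightarrow> prob_space (driving_law L \<rho>)"
  unfolding driving_law_def
  by (intro prob_space_pair prob_space_noise measure_pmf.prob_space_axioms)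

lemma fst_driving_law [measurable]: "fst \<in> measurable (driving_law L \<rho>) (count_space UNIV)"
proof -
  have "fst \<in> measurable (driving_law L \<rho>) (measure_pmf \<rho>)" unfolding driving_law_def by simp
  then show ?thesis by (simp cong: measurable_cong_sets)
qed

lemma snd_driving_law [measurable]: "snd \<in> measurable (driving_law L \<rho>) (noise L)"
  unfolding driving_law_def by simp

text \<open>
  On the null set of starting points outside the support and of exploding noise, the trajectory is made
  constant. Regularity and invariants then hold along every trajectory without exception.
\<close>

definition trajectory ::
  "('s::countable \<Rightarrow> 's pmf) \<Rightarrow> 's pmf \<Rightarrow> real \<Rightarrow> 's \<times> (nat \<Rightarrow> real \<times> real) \<Rightarrow> 's" where
  "trajectory J \<rho> t p = (if fst p \<in> set_pmf \<rho> \<and> alive_forever (snd p) then state_at J t (fst p) (snd p)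
     else SOME s. s \<in> set_pmf \<rho>)"

lemma trajectory_measurable [measurable]: "trajectory J \<rho> t \<in> measurable (driving_law L \<rho>) (count_space UNIV)"
proof -
  have "(\<lambda>p. state_at J t s (snd p)) \<in> measurable (driving_law L \<rho>) (count_space UNIV)" for s by measurable
  from measurable_compose_countable[OF this fst_driving_law]
  have [measurable]: "(\<lambda>p. state_at J t (fst p) (snd p)) \<in> measurable (driving_law L \<rho>) (count_space UNIV)" .
  have [measurable]: "Measurable.pred (driving_law L \<rho>) (\<lambda>p. fst p \<in> set_pmf \<rho>)"
    by (rule measurable_compose[OF fst_driving_law]) simp
  show ?thesis unfolding trajectory_def[abs_def] by measurable
qed

lemma chain_invariant:
  assumes "\<And>s s'. I s \<Longrightarrow> s' \<in> set_pmf (J s) \<Longrightarrow> I s'" "I s"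
  shows "I (chain J n s w)"
  using assms(2)
proof (induction n arbitrary: s w)
  case (Suc n)
  then show ?case using assms(1)[OF _ quantile_in_set_pmf] by simp
qed simp

lemma trajectory_invariant:
  assumes "\<And>s s'. I s \<Longrightarrow> s' \<in> set_pmf (J s) \<Longrightarrow> I s'" "\<And>s. s \<in> set_pmf \<rho> \<Longrightarrow> I s"
  shows "I (trajectory J \<rho> t p)"
proof -
  have "(SOME s. s \<in> set_pmf \<rho>) \<in> set_pmf \<rho>" using set_pmf_not_empty by (simp add: some_in_eq)
  then show ?thesis
    using assms(2) chain_invariant[of I J, OF assms(1)] by (auto simp: trajectory_def state_at_def)
qed

lemma trajectory_at_right: 
  assumes "0 \<le> t"
  shows "\<forall>\<^sub>F u in at_right t. trajectory J \<rho> u p = trajectory J \<rho> t p"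
proof (cases "fst p \<in> set_pmf \<rho> \<and> alive_forever (snd p)")
  case True
  then obtain n where n: "jump_count n t (snd p)" using assms by (auto simp: alive_forever_def alive_def)
  show ?thesis
    using jump_count_at_right[OF n] by eventually_elim (use n in \<open>simp add: trajectory_def state_at_def njumps_eq\<close>)
qed (auto simp: trajectory_def)

lemma trajectory_at_left: 
  assumes "0 < t"
  shows "\<exists>x. \<forall>\<^sub>F u in at_left t. trajectory J \<rho> u p = x"
proof (cases "fst p \<in> set_pmf \<rho> \<and> alive_forever (snd p)")
  case True
  then have "alive t (snd p)" using assms by (simp add: alive_forever_def)
  then obtain n where n: "jump_count n t (snd p)" by (auto simp: alive_def)
  obtain m where m: "\<forall>\<^sub>F u in at_left t. jump_count m u (snd p)" using jump_count_at_left[OF n] .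
  have "\<forall>\<^sub>F u in at_left t. trajectory J \<rho> u p = chain J m (fst p) (snd p)"
    using m by eventually_elim (use True in \<open>simp add: trajectory_def state_at_def njumps_eq\<close>)
  then show ?thesis ..
qed (auto simp: trajectory_def)

lemma emeasure_driving_law:
  assumes L: "0 < L" and Q: "Measurable.pred (driving_law L \<rho>) Q"
  shows "emeasure (driving_law L \<rho>) {p. Q p} = (\<integral>\<^sup>+s. emeasure (noise L) {w. Q (s, w)} \<partial>measure_pmf \<rho>)"
proof -
  interpret n: prob_space "noise L" by (rule prob_space_noise[OF L])
  have "{p. Q p} \<in> sets (driving_law L \<rho>)" using Q by (drule_tac predE) simp
  then show ?thesis
    unfolding driving_law_def by (subst n.emeasure_pair_measure_alt) (auto simp: vimage_def)
qed

lemma trajectory_law: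
  fixes J :: "'s::countable \<Rightarrow> 's pmf" and h :: "'s \<Rightarrow> 'x"
  assumes L: "0 < L" and lump: "\<And>s. map_pmf h (J s) = P (h s)"
    and t: "0 \<le> t 0" "\<And>i. i < k \<Longrightarrow> t i \<le> t (Suc i)"
  shows "emeasure (driving_law L \<rho>) {p. \<forall>i\<le>k. h (trajectory J \<rho> (t i) p) = x i} =
    (\<integral>\<^sup>+s. ennreal (pmf (uniformized_kernel L P (t 0) (h s)) (x 0)) \<partial>measure_pmf \<rho>) *
    ennreal (\<Prod>i<k. pmf (uniformized_kernel L P (t (Suc i) - t i) (x i)) (x (Suc i)))"
proof -
  have hm: "Measurable.pred (driving_law L \<rho>) (\<lambda>p. h (trajectory J \<rho> u p) = y)" for u y
    by (rule measurable_compose[OF trajectory_measurable, where g="\<lambda>s. h s = y"]) simp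
  have hm2: "Measurable.pred (noise L) (\<lambda>w. h (state_at J u s w) = y)" for u y s
    by (rule measurable_compose[OF state_at_measurable, where g="\<lambda>s. h s = y"]) simp
  have hm3: "Measurable.pred (noise L) (\<lambda>w. h (trajectory J \<rho> u (s, w)) = y)" for u y s
  proof -
    have "Pair s \<in> measurable (noise L) (driving_law L \<rho>)" unfolding driving_law_def by simp
    from measurable_compose[OF this hm] show ?thesis .
  qed
  have t0: "0 \<le> t i" if "i \<le> k" for i
    using that by (induction i) (use t in \<open>auto intro: order.trans\<close>)
  have "emeasure (driving_law L \<rho>) {p. \<forall>i\<le>k. h (trajectory J \<rho> (t i) p) = x i} =
      (\<integral>\<^sup>+s. emeasure (noise L) {w. \<forall>i\<le>k. h (trajectory J \<rho> (t i) (s, w)) = x i} \<partial>measure_pmf \<rho>)"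
    by (intro emeasure_driving_law[OF L] pred_intros_countable pred_intros_imp' hm)
  also have "\<dots> = (\<integral>\<^sup>+s. ennreal (pmf (uniformized_kernel L P (t 0) (h s)) (x 0)) *
      ennreal (\<Prod>i<k. pmf (uniformized_kernel L P (t (Suc i) - t i) (x i)) (x (Suc i))) \<partial>measure_pmf \<rho>)"
  proof (rule nn_integral_cong_AE, rule AE_pmfI)
    fix s assume s: "s \<in> set_pmf \<rho>"
    have "emeasure (noise L) {w. \<forall>i\<le>k. h (trajectory J \<rho> (t i) (s, w)) = x i} =
        emeasure (noise L) {w. \<forall>i\<le>k. alive (t i) w \<and> h (state_at J (t i) s w) = x i}"
    proof (rule emeasure_eq_AE)
      show "AE w in noise L. w \<in> {w. \<forall>i\<le>k. h (trajectory J \<rho> (t i) (s, w)) = x i} \<longleftrightarrow>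
          w \<in> {w. \<forall>i\<le>k. alive (t i) w \<and> h (state_at J (t i) s w) = x i}"
        using AE_alive[OF L] by eventually_elim (use s t0 in \<open>auto simp: trajectory_def alive_forever_def\<close>)
      show "{w. \<forall>i\<le>k. h (trajectory J \<rho> (t i) (s, w)) = x i} \<in> sets (noise L)"
        by (intro pred_noise_sets pred_intros_countable pred_intros_imp' hm3)
      show "{w. \<forall>i\<le>k. alive (t i) w \<and> h (state_at J (t i) s w) = x i} \<in> sets (noise L)"
        by (intro pred_noise_sets pred_intros_countable pred_intros_imp' pred_intros_logic
            alive_measurable hm2)
    qed
    also have "\<dots> = ennreal (pmf (uniformized_kernel L P (t 0) (h s)) (x 0)) *
      ennreal (\<Prod>i<k. pmf (uniformized_kernel L P (t (Suc i) - t i) (x i)) (x (Suc i)))"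
      by (subst finite_dimensional_law[where h=h and P=P, OF L lump t]) (auto simp: ennreal_mult prod_nonneg)
    finally show "emeasure (noise L) {w. \<forall>i\<le>k. h (trajectory J \<rho> (t i) (s, w)) = x i} = \<dots>" .
  qed
  also have "\<dots> = (\<integral>\<^sup>+s. ennreal (pmf (uniformized_kernel L P (t 0) (h s)) (x 0)) \<partial>measure_pmf \<rho>) *
      ennreal (\<Prod>i<k. pmf (uniformized_kernel L P (t (Suc i) - t i) (x i)) (x (Suc i)))"
    by (rule nn_integral_multc) simp
  finally show ?thesis .
qed

lemma trajectory_0_law:
  assumes L: "0 < L"
  shows "distr (driving_law L \<rho>) (count_space UNIV) (trajectory J \<rho> 0) = measure_pmf \<rho>"
proof (rule measure_eqI_countable[where A=UNIV])
  fix s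
  have "emeasure (distr (driving_law L \<rho>) (count_space UNIV) (trajectory J \<rho> 0)) {s} =
      emeasure (driving_law L \<rho>) {p. \<forall>i\<le>(0::nat). id (trajectory J \<rho> ((\<lambda>_. 0) i) p) = (\<lambda>_. s) i}"
    by (subst emeasure_distr) (auto simp: vimage_def)
  also have "\<dots> = (\<integral>\<^sup>+s'. ennreal (pmf (return_pmf s') s) \<partial>measure_pmf \<rho>)"
    by (subst trajectory_law[OF L, where P=J]) (auto simp: uniformized_kernel_0 pmf.map_id)
  also have "\<dots> = emeasure (measure_pmf \<rho>) {s}"
    by (simp only: ennreal_pmf_bind[symmetric] bind_return_pmf' emeasure_pmf_single)
  finally show "emeasure (distr (driving_law L \<rho>) (count_space UNIV) (trajectory J \<rho> 0)) {s} =
      emeasure (measure_pmf \<rho>) {s}" .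
qed auto

text \<open>
  The underlying probability space is moved to real sequences by an injective encoding with measurable
  left inverse; holding times and uniform variables are interleaved behind the initial state.
\<close>

definition encode :: "'s::countable \<times> (nat \<Rightarrow> real \<times> real) \<Rightarrow> nat \<Rightarrow> real" where
  "encode p n = (case n of 0 \<Rightarrow> real (to_nat (fst p))
     | Suc m \<Rightarrow> if even m then fst (snd p (m div 2)) else snd (snd p (m div 2)))"

definition decode :: "(nat \<Rightarrow> real) \<Rightarrow> 's::countable \<times> (nat \<Rightarrow> real \<times> real)" where
  "decode w = (from_nat (nat \<lfloor>w 0\<rfloor>), \<lambda>n. (w (Suc (2 * n)), w (Suc (Suc (2 * n)))))"

lemma decode_encode [simp]: "decode (encode p) = p"
  by (cases p) (simp add: decode_def encode_def)

lemma encode_measurable [measurable]: "encode \<in> measurable (driving_law L \<rho>) (\<Pi>\<^sub>M i\<in>UNIV. borel)"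
proof -
  have "(\<lambda>p. encode p n) \<in> borel_measurable (driving_law L \<rho>)" for n
  proof (cases n)
    case 0
    have "(\<lambda>p. real (to_nat (fst p))) \<in> borel_measurable (driving_law L \<rho>)"
      by (rule measurable_compose[OF fst_driving_law]) simp
    with 0 show ?thesis by (simp add: encode_def)
  next
    case (Suc m)
    have [measurable]: "(\<lambda>p. snd p k) \<in> measurable (driving_law L \<rho>) (borel \<Otimes>\<^sub>M borel)" for k
      by (rule measurable_compose[OF snd_driving_law noise_nth])
    show ?thesis unfolding encode_def Suc by simp
  qed
  then show ?thesis
    by (intro measurable_PiM_single') auto
qed

lemma decode_measurable [measurable]: "decode \<in> measurable (\<Pi>\<^sub>M i\<in>UNIV. borel) (driving_law L \<rho>)"
proof -
  let ?N = "(\<Pi>\<^sub>M i\<in>UNIV. borel) :: (nat \<Rightarrow> real) measure"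
  have "(\<lambda>w. from_nat (nat \<lfloor>w 0\<rfloor>)) \<in> measurable ?N (count_space UNIV)"
    by measurable
  then have 1: "(\<lambda>w. from_nat (nat \<lfloor>w 0\<rfloor>)) \<in> measurable ?N (measure_pmf \<rho>)"
    by (simp cong: measurable_cong_sets)
  have 2: "(\<lambda>w n. (w (Suc (2 * n)), w (Suc (Suc (2 * n))))) \<in> measurable ?N (noise L)"
    unfolding noise_def
  proof (rule measurable_PiM_single')
    fix n
    have "(\<lambda>w. (w (Suc (2 * n)), w (Suc (Suc (2 * n))))) \<in> measurable ?N (borel \<Otimes>\<^sub>M borel)"
      by measurable
    then show "(\<lambda>w. (w (Suc (2 * n)), w (Suc (Suc (2 * n))))) \<in> measurable ?N (step_noise L)"
      by (simp cong: measurable_cong_sets)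
  qed auto
  show ?thesis
    unfolding decode_def[abs_def] driving_law_def using 1 2 by (rule measurable_Pair)
qed

text \<open>
  A single process \<open>Z\<close> serves all observation functions \<open>h\<close>. Applied to the two projections of a product
  type, this says that a Markov chain on pairs whose marginal kernels are \<open>P\<close> and \<open>P'\<close> couples the two
  corresponding jump processes, and invariants of the chain hold at all times.
\<close>

theorem uniformized_process:
  fixes J :: "'s::countable \<Rightarrow> 's pmf" and \<rho> :: "'s pmf" and I :: "'s \<Rightarrow> bool"
  assumes L: "0 < L"
    and step: "\<And>s s'. I s \<Longrightarrow> s' \<in> set_pmf (J s) \<Longrightarrow> I s'"
    and init: "\<And>s. s \<in> set_pmf \<rho> \<Longrightarrow> I s"
  obtains \<Omega> :: "(nat \<Rightarrow> real) measure" and Z where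
    "\<And>(h :: 's \<Rightarrow> 'x::countable) P q. (\<And>s. map_pmf h (J s) = P (h s)) \<Longrightarrow>
       (\<And>x y. x \<noteq> y \<Longrightarrow> q x y = L * pmf (P x) y) \<Longrightarrow>
       markov_jump_process \<Omega> q (\<lambda>t \<omega>. h (Z t \<omega>))"
    "distr \<Omega> (count_space UNIV) (Z 0) = measure_pmf \<rho>"
    "\<And>t \<omega>. I (Z t \<omega>)"
proof -
  interpret sl: prob_space "driving_law L \<rho>" by (rule prob_space_driving_law[OF L])
  let ?N = "(\<Pi>\<^sub>M i\<in>UNIV. borel) :: (nat \<Rightarrow> real) measure"
  define \<Omega> where "\<Omega> = distr (driving_law L \<rho>) ?N encode"
  define Z where "Z t \<omega> = trajectory J \<rho> t (decode \<omega>)" for t \<omega>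
  have sp: "space \<Omega> = UNIV" by (simp add: \<Omega>_def space_PiM)
  have ps: "prob_space \<Omega>" unfolding \<Omega>_def by (rule sl.prob_space_distr) measurable
  have Z: "Z t \<in> measurable \<Omega> (count_space UNIV)" for t
  proof -
    have "(\<lambda>\<omega>. trajectory J \<rho> t (decode \<omega>)) \<in> measurable ?N (count_space UNIV)"
      by (rule measurable_compose[OF decode_measurable trajectory_measurable])
    then show ?thesis by (simp add: Z_def[abs_def] \<Omega>_def)
  qed
  have law: "emeasure \<Omega> {\<omega>. Q (decode \<omega>)} = emeasure (driving_law L \<rho>) {p. Q p}"
    if Q: "Measurable.pred (driving_law L \<rho>) Q" for Q
  proof -
    have "{\<omega> \<in> space ?N. Q (decode \<omega>)} \<in> sets ?N"
      using measurable_compose[OF decode_measurable Q] by (rule predE)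
    then have "{\<omega>. Q (decode \<omega>)} \<in> sets ?N" by (simp add: space_PiM)
    then show ?thesis
      unfolding \<Omega>_def by (subst emeasure_distr) (auto simp: vimage_def)
  qed
  have markov: "markov_jump_process \<Omega> q (\<lambda>t \<omega>. h (Z t \<omega>))"
    if lump: "\<And>s. map_pmf h (J s) = P (h s)" and q: "\<And>x y. x \<noteq> y \<Longrightarrow> q x y = L * pmf (P x) y"
    for h :: "'s \<Rightarrow> 'x::countable" and P q
    unfolding markov_jump_process_def
  proof (intro conjI exI[of _ "uniformized_kernel L P"] ballI allI impI)
    show "prob_space \<Omega>" by (rule ps)
    show "(\<lambda>\<omega>. h (Z t \<omega>)) \<in> measurable \<Omega> (count_space UNIV)" for t
      by (rule measurable_compose[OF Z]) simp
    show "transition_function q (uniformized_kernel L P)"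
      using L q by (rule transition_function_uniformized_kernel)
  next
    fix \<omega> and t :: real assume "0 \<le> t"
    show "\<forall>\<^sub>F u in at_right t. h (Z u \<omega>) = h (Z t \<omega>)"
      using trajectory_at_right[OF \<open>0 \<le> t\<close>, where J=J and \<rho>=\<rho> and p="decode \<omega>"] unfolding Z_def by (rule eventually_mono) simp
  next
    fix \<omega> and t :: real assume "0 < t"
    obtain x where "\<forall>\<^sub>F u in at_left t. Z u \<omega> = x"
      using trajectory_at_left[OF \<open>0 < t\<close>] unfolding Z_def by blast
    then have "\<forall>\<^sub>F u in at_left t. h (Z u \<omega>) = h x" by (rule eventually_mono) simp
    then show "\<exists>x. \<forall>\<^sub>F u in at_left t. h (Z u \<omega>) = x" ..
  next
    fix k and t :: "nat \<Rightarrow> real" and x :: "nat \<Rightarrow> 'x"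
    assume t: "0 \<le> t 0" "\<forall>i\<le>k. t i \<le> t (Suc i)"
    let ?a = "\<integral>\<^sup>+s. ennreal (pmf (uniformized_kernel L P (t 0) (h s)) (x 0)) \<partial>measure_pmf \<rho>"
    let ?b = "\<lambda>j. \<Prod>i<j. pmf (uniformized_kernel L P (t (Suc i) - t i) (x i)) (x (Suc i))"
    have fdd: "measure \<Omega> {\<omega> \<in> space \<Omega>. \<forall>i\<le>j. h (Z (t i) \<omega>) = x i} = enn2real ?a * ?b j"
      if j: "j \<le> Suc k" for j
    proof -
      have hm: "Measurable.pred (driving_law L \<rho>) (\<lambda>p. h (trajectory J \<rho> u p) = y)" for u y
        by (rule measurable_compose[OF trajectory_measurable, where g="\<lambda>s. h s = y"]) simp
      have "emeasure \<Omega> {\<omega> \<in> space \<Omega>. \<forall>i\<le>j. h (Z (t i) \<omega>) = x i} =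
          emeasure (driving_law L \<rho>) {p. \<forall>i\<le>j. h (trajectory J \<rho> (t i) p) = x i}"
        unfolding sp Z_def
        by (subst law[symmetric]) (auto intro!: pred_intros_countable pred_intros_imp' hm)
      also have "\<dots> = ?a * ennreal (?b j)"
        by (rule trajectory_law[where h=h and P=P, OF L lump]) (use t j in auto)
      finally show ?thesis
        by (simp add: measure_def enn2real_mult prod_nonneg)
    qed
    show "measure \<Omega> {\<omega> \<in> space \<Omega>. \<forall>i\<le>Suc k. h (Z (t i) \<omega>) = x i} =
        measure \<Omega> {\<omega> \<in> space \<Omega>. \<forall>i\<le>k. h (Z (t i) \<omega>) = x i} *
          pmf (uniformized_kernel L P (t (Suc k) - t k) (x k)) (x (Suc k))"
      by (subst (1 2) fdd) (auto simp: mult.assoc)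
  qed
  have "distr \<Omega> (count_space UNIV) (Z 0) = distr (driving_law L \<rho>) (count_space UNIV) (trajectory J \<rho> 0)"
    using Z[of 0] unfolding \<Omega>_def
    by (subst distr_distr) (auto simp: comp_def Z_def)
  then have "distr \<Omega> (count_space UNIV) (Z 0) = measure_pmf \<rho>"
    by (simp add: trajectory_0_law[OF L])
  moreover have "I (Z t \<omega>)" for t \<omega>
    unfolding Z_def by (rule trajectory_invariant[of I, OF step init])
  ultimately show ?thesis using markov that by blast
qed

section \<open>Couplings of random servers\<close>

text \<open>
  The functions \<open>f\<close> and \<open>g\<close> sort the two types into finitely many classes. Enumerating class by class, with
  ties broken by the injection into the natural numbers, turns every set \<open>f v < c\<close> into an initial segment.
\<close>

lemma class_coupling:
  fixes p :: "'a::finite pmf" and q :: "'b::finite pmf" and f :: "'a \<Rightarrow> nat" and g :: "'b \<Rightarrow> nat"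
  obtains D where "map_pmf fst D = p" "map_pmf snd D = q"
    "\<And>v w c. (v, w) \<in> set_pmf D \<Longrightarrow>
       measure_pmf.prob p {v. f v < c} \<le> measure_pmf.prob q {w. g w < c} \<Longrightarrow> f v < c \<Longrightarrow> g w < c"
proof -
  define N where "N = Suc (Max (range (to_nat :: 'a \<Rightarrow> nat) \<union> range (to_nat :: 'b \<Rightarrow> nat)))"
  have N: "to_nat v < N" "to_nat w < N" for v :: 'a and w :: 'b
    unfolding N_def by (auto intro!: le_imp_less_Suc Max_ge)
  define e where "e v = f v * N + to_nat v" for v
  define e' where "e' w = g w * N + to_nat w" for w
  have key: "i * N + r < c * N \<longleftrightarrow> i < c" if "r < N" for i r c
  proof
    assume "i < c"
    then have "Suc i * N \<le> c * N" by (intro mult_le_mono1) simp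
    with that show "i * N + r < c * N" by simp
  next
    assume "i * N + r < c * N"
    then have "i * N < c * N" by linarith
    then show "i < c" by simp
  qed
  have inj: "i * N + r = i' * N + r' \<Longrightarrow> r = r'" if "r < N" "r' < N" for i r i' r'
    using that by (metis mod_less mod_mult_self3)
  have e: "inj e" and e': "inj e'"
    using inj[OF N(1) N(1)] inj[OF N(2) N(2)] by (auto intro!: injI simp: e_def e'_def)
  have less: "e v < c * N \<longleftrightarrow> f v < c" "e' w < c * N \<longleftrightarrow> g w < c" for v w c
    using key[OF N(1)] key[OF N(2)] by (simp_all add: e_def e'_def)
  obtain D where D: "map_pmf fst D = p" "map_pmf snd D = q"
    "\<And>v w k l. (v, w) \<in> set_pmf D \<Longrightarrow> cum_prob p e k \<le> cum_prob q e' l \<Longrightarrow> e v < k \<Longrightarrow> e' w < l"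
    using quantile_coupling[OF e e', of p q] by blast
  show ?thesis
  proof (rule that[OF D(1,2)])
    fix v w c
    assume "(v, w) \<in> set_pmf D" "measure_pmf.prob p {v. f v < c} \<le> measure_pmf.prob q {w. g w < c}" "f v < c"
    with D(3)[of v w "c * N" "c * N"] show "g w < c" by (simp add: cum_prob_def less)
  qed
qed

text \<open>
  Cancelling the common part \<open>A \<inter> B\<close>, what remains of \<open>A\<close> embeds into what remains of \<open>B\<close>, and any such
  injection maps every element to one of at least its weight.
\<close>

lemma sum_le_sum_top:
  fixes m :: "'a::finite \<Rightarrow> real"
  assumes "card A \<le> card B" and top: "\<And>v w. v \<notin> B \<Longrightarrow> w \<in> B \<Longrightarrow> m v \<le> m w"
    and nonneg: "\<And>v. 0 \<le> m v"
  shows "sum m A \<le> sum m B"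
proof -
  have "card (A - B) \<le> card (B - A)"
    using assms(1) by (simp add: card_Diff_subset_Int Int_commute)
  then obtain \<phi> where \<phi>: "\<phi> ` (A - B) \<subseteq> B - A" "inj_on \<phi> (A - B)"
    using inj_on_iff_card_le[of "A - B" "B - A"] by auto
  have "sum m (A - B) \<le> (\<Sum>v\<in>A - B. m (\<phi> v))"
    using \<phi>(1) by (intro sum_mono top) auto
  also have "\<dots> = sum m (\<phi> ` (A - B))" using \<phi>(2) by (simp add: sum.reindex)
  also have "\<dots> \<le> sum m (B - A)" using \<phi>(1) nonneg by (intro sum_mono2) auto
  finally have "sum m (A - B) + sum m (A \<inter> B) \<le> sum m (B - A) + sum m (B \<inter> A)"
    by (simp add: Int_commute)
  then show ?thesis
    by (metis finite sum.Int_Diff add.commute)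
qed

lemma finite_pmf_exists:
  fixes m :: "'a::finite \<Rightarrow> real"
  assumes "\<And>v. 0 \<le> m v" "sum m UNIV = 1"
  obtains p where "\<And>v. pmf p v = m v"
proof
  show "pmf (embed_pmf m) v = m v" for v
    using assms by (intro pmf_embed_pmf) (auto simp: nn_integral_count_space_finite)
qed

section \<open>Numbers of jobs\<close>

definition total_jobs :: "('v::finite \<Rightarrow> nat) \<Rightarrow> nat" where
  "total_jobs x = (\<Sum>v\<in>UNIV. x v)"

text \<open>
  In a state of the original system this is \<open>Q\<^sub>+\<^sub>2\<close>, counted server by server instead of level by level;
  in a state with at most two jobs per queue it is the number of queues with two jobs.
\<close>

definition waiting_jobs :: "('v::finite \<Rightarrow> nat) \<Rightarrow> nat" where
  "waiting_jobs x = (\<Sum>v\<in>UNIV. x v - 1)"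

lemma sum_occ:
  assumes "\<And>v. pool v \<in> {1..M}"
  shows "(\<Sum>j=1..M. occ pool j i x) = card {v. i \<le> x v}"
proof -
  have "card {v. i \<le> x v} = (\<Sum>v | i \<le> x v. 1)" by simp
  also have "\<dots> = (\<Sum>j=1..M. \<Sum>v | v \<in> {v. i \<le> x v} \<and> pool v = j. 1)"
    by (rule sum.group[symmetric]) (use assms in auto)
  also have "\<dots> = (\<Sum>j=1..M. occ pool j i x)"
    by (intro sum.cong) (auto simp: occ_def intro!: arg_cong[where f=card])
  finally show ?thesis ..
qed

lemma total_jobs_eq: "total_jobs x = card {v. 1 \<le> x v} + waiting_jobs x"
proof -
  have "total_jobs x = (\<Sum>v\<in>UNIV. of_bool (1 \<le> x v) + (x v - 1))"
    unfolding total_jobs_def by (intro sum.cong) auto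
  also have "\<dots> = card {v. 1 \<le> x v} + waiting_jobs x"
    by (simp add: sum.distrib waiting_jobs_def flip: of_nat_sum)
  finally show ?thesis .
qed

lemma Q2plus_eq_waiting_jobs:
  assumes pool: "\<And>v. pool v \<in> {1..M}"
  shows "Q2plus M pool x = waiting_jobs x"
proof -
  define m where "m = Max (range x)"
  have m: "x v \<le> m" for v unfolding m_def by (rule Max_ge) auto
  have fin: "(\<Sum>\<^sub>\<infinity>i\<in>{2..}. occ pool j i x) = (\<Sum>i=2..m. occ pool j i x)" for j
  proof -
    have "occ pool j i x = 0" if "m < i" for i
      using m that by (auto simp: occ_def dest: le_less_trans)
    then have "(\<Sum>\<^sub>\<infinity>i\<in>{2..}. occ pool j i x) = (\<Sum>\<^sub>\<infinity>i\<in>{2..m}. occ pool j i x)"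
      by (intro infsum_cong_neutral) auto
    then show ?thesis by simp
  qed
  have "Q2plus M pool x = (\<Sum>i=2..m. card {v. i \<le> x v})"
    unfolding Q2plus_def fin by (subst sum.swap) (simp only: sum_occ[OF pool])
  also have "\<dots> = (\<Sum>i=2..m. \<Sum>v\<in>UNIV. of_bool (i \<le> x v))"
    by (intro sum.cong) auto
  also have "\<dots> = (\<Sum>v\<in>UNIV. \<Sum>i=2..m. of_bool (i \<le> x v))"
    by (rule sum.swap)
  also have "\<dots> = (\<Sum>v\<in>UNIV. card {2..x v})"
  proof (intro sum.cong refl)
    fix v
    have "{i \<in> {2..m}. i \<le> x v} = {2..x v}" using m[of v] by auto
    then show "(\<Sum>i=2..m. of_bool (i \<le> x v)) = card {2..x v}" by (simp add: Int_def)
  qed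
  also have "\<dots> = waiting_jobs x" by (auto simp: waiting_jobs_def intro!: sum.cong)
  finally show ?thesis .
qed

lemma Q1_eq:
  assumes "\<And>v. pool v \<in> {1..M}"
  shows "Q1 M pool x = card {v. 1 \<le> x v}"
  unfolding Q1_def by (rule sum_occ[OF assms])

lemma Qt_2_eq_waiting_jobs:
  assumes "\<And>a. y a \<le> 2"
  shows "Qt 2 y = waiting_jobs y"
proof -
  have "y a - 1 = of_bool (2 \<le> y a)" for a using assms[of a] by auto
  then show ?thesis by (simp add: waiting_jobs_def Qt_def)
qed

lemma card_le_waiting_jobs: "card {v. 2 \<le> x v} \<le> waiting_jobs x"
proof -
  have "card {v. 2 \<le> x v} = (\<Sum>v\<in>UNIV. of_bool (2 \<le> x v))" by simp
  also have "\<dots> \<le> waiting_jobs x" unfolding waiting_jobs_def by (intro sum_mono) auto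
  finally show ?thesis .
qed

lemma total_jobs_upd: "total_jobs (x(v := k)) + x v = total_jobs x + k"
  unfolding total_jobs_def by (subst (1 2) sum.remove[of UNIV v]) auto

lemma waiting_jobs_upd: "waiting_jobs (x(v := k)) + (x v - 1) = waiting_jobs x + (k - 1)"
  unfolding waiting_jobs_def by (subst (1 2) sum.remove[of UNIV v]) auto

section \<open>Domination is preserved by every event\<close>

text \<open>
  The inequalities of the proposition for a state \<open>y\<close> of the modified and \<open>x\<close> of the original system,
  together with the buffer bound on which the reading of \<open>waiting_jobs y\<close> as the number of full queues relies.
\<close>

definition dominated :: "('v::finite \<Rightarrow> nat) \<Rightarrow> ('v \<Rightarrow> nat) \<Rightarrow> bool" where
  "dominated y x \<longleftrightarrow> (\<forall>a. y a \<le> 2) \<and> total_jobs y \<le> total_jobs x \<and> waiting_jobs y \<le> waiting_jobs x"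

text \<open>
  Arrivals need no coupling beyond their times. The only threat is that the job has to wait in the
  modified system but not in the original one, where it finds an idle server. By JSQ all queues
  of the modified system are then busy, so that it has strictly more busy queues than the original
  system has busy servers; as it has no more jobs in total, fewer of them were waiting.
\<close>

lemma dominated_arrival:
  fixes x y :: "'v::finite \<Rightarrow> nat"
  assumes dom: "dominated y x" and jsq: "\<And>b. y a \<le> y b"
  shows "dominated (if y a < 2 then y(a := y a + 1) else y) (x(v := x v + 1))"
proof -
  have tx: "total_jobs (x(v := x v + 1)) = total_jobs x + 1" using total_jobs_upd[of x v "x v + 1"] by simp
  have wx: "waiting_jobs (x(v := x v + 1)) = waiting_jobs x + of_bool (1 \<le> x v)"
    using waiting_jobs_upd[of x v "x v + 1"] by auto
  show ?thesis
  proof (cases "y a < 2")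
    case False
    then show ?thesis using dom tx wx by (auto simp: dominated_def)
  next
    case True
    have ty: "total_jobs (y(a := y a + 1)) = total_jobs y + 1" using total_jobs_upd[of y a "y a + 1"] by simp
    have wy: "waiting_jobs (y(a := y a + 1)) = waiting_jobs y + of_bool (1 \<le> y a)"
      using waiting_jobs_upd[of y a "y a + 1"] by auto
    have "waiting_jobs y + of_bool (1 \<le> y a) \<le> waiting_jobs x + of_bool (1 \<le> x v)"
    proof (cases "y a = 0 \<or> 1 \<le> x v")
      case True
      then show ?thesis using dom by (auto simp: dominated_def)
    next
      case False
      have "1 \<le> y b" for b using False jsq[of b] by auto
      then have "{b. 1 \<le> y b} = UNIV" by auto
      then have "total_jobs y = CARD('v) + waiting_jobs y" using total_jobs_eq[of y] by simp
      moreover have "card {u. 1 \<le> x u} < CARD('v)"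
        using False by (intro psubset_card_mono) auto
      ultimately show ?thesis
        using dom total_jobs_eq[of x] by (simp add: dominated_def)
    qed
    then show ?thesis using dom True tx wx ty wy by (auto simp: dominated_def)
  qed
qed

text \<open>
  Each inequality can be lost only if it was an equality before. If the numbers of waiting jobs agree,
  the original system has at most as many servers with two or more jobs as the modified system has full queues.
  If the total numbers agree, the original system has at most as many busy servers as there are busy queues.
  In either case the hypothesis on the coupled services lets the modified system lose a job, too.
\<close>

lemma dominated_departure:
  fixes x y :: "'v::finite \<Rightarrow> nat"
  assumes dom: "dominated y x"
    and cpl: "\<And>i. i \<in> {1, 2} \<Longrightarrow> card {v. i \<le> x v} \<le> card {a. i \<le> y a} \<Longrightarrow> i \<le> x v \<Longrightarrow> i \<le> y a"
  shows "dominated (y(a := y a - 1)) (x(v := x v - 1))"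
proof -
  have tx: "total_jobs (x(v := x v - 1)) + of_bool (1 \<le> x v) = total_jobs x"
    using total_jobs_upd[of x v "x v - 1"] by auto
  have ty: "total_jobs (y(a := y a - 1)) + of_bool (1 \<le> y a) = total_jobs y"
    using total_jobs_upd[of y a "y a - 1"] by auto
  have wx: "waiting_jobs (x(v := x v - 1)) + of_bool (2 \<le> x v) = waiting_jobs x"
    using waiting_jobs_upd[of x v "x v - 1"] by auto
  have wy: "waiting_jobs (y(a := y a - 1)) + of_bool (2 \<le> y a) = waiting_jobs y"
    using waiting_jobs_upd[of y a "y a - 1"] by auto
  have y2: "\<And>b. y b \<le> 2" and le: "total_jobs y \<le> total_jobs x" "waiting_jobs y \<le> waiting_jobs x"
    using dom by (auto simp: dominated_def)
  have "waiting_jobs (y(a := y a - 1)) \<le> waiting_jobs (x(v := x v - 1))"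
  proof (cases "waiting_jobs y = waiting_jobs x")
    case True
    then have "card {v. 2 \<le> x v} \<le> card {a. 2 \<le> y a}"
      using card_le_waiting_jobs[of x] Qt_2_eq_waiting_jobs[of y, OF y2] by (simp add: Qt_def)
    then have "2 \<le> x v \<Longrightarrow> 2 \<le> y a" using cpl[of 2] by simp
    then show ?thesis using True wx wy by (cases "2 \<le> x v") auto
  next
    case False
    then show ?thesis using le(2) wx wy by (auto simp: of_bool_def split: if_splits)
  qed
  moreover have "total_jobs (y(a := y a - 1)) \<le> total_jobs (x(v := x v - 1))"
  proof (cases "total_jobs y = total_jobs x")
    case True
    then have "card {v. 1 \<le> x v} \<le> card {a. 1 \<le> y a}"
      using total_jobs_eq[of x] total_jobs_eq[of y] le(2) by simp
    then have "1 \<le> x v \<Longrightarrow> 1 \<le> y a" using cpl[of 1] by simp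
    then show ?thesis using True tx ty by (cases "1 \<le> x v") auto
  next
    case False
    then show ?thesis using le(1) tx ty by (auto simp: of_bool_def split: if_splits)
  qed
  moreover have "(y(a := y a - 1)) b \<le> 2" for b using y2[of b] by auto
  ultimately show ?thesis by (simp add: dominated_def)
qed

text \<open>
  A service completion takes place at a server drawn with probability proportional to its speed, and
  it is void if nothing is served there. The queues with \<open>i\<close> or more jobs occupy the fastest servers in the
  modified system, so at least as many of them means at least as much probability, and the quantile
  coupling makes their service follow from that of the servers with \<open>i\<close> or more jobs in the original
  system. Measuring a queue by \<open>2 - x v\<close> makes long queues come first.
\<close>

lemma service_coupling:
  fixes pool :: "'v::finite \<Rightarrow> nat" and x y :: "'v \<Rightarrow> nat"
  assumes arr: "rearrangement mu pool arr"
    and nonneg: "\<And>v. 0 \<le> mu (pool v)" and c: "0 \<le> c"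
    and p: "\<And>v. pmf p v = c * mu (pool v)"
  obtains D where "map_pmf fst D = p" "map_pmf snd D = p"
    "\<And>v w i. (v, w) \<in> set_pmf D \<Longrightarrow> i \<in> {1, 2} \<Longrightarrow> card {v. i \<le> x v} \<le> card {a. i \<le> y a} \<Longrightarrow>
       i \<le> x v \<Longrightarrow> i \<le> y (inv (arr y) w)"
proof -
  let ?g = "\<lambda>w. y (inv (arr y) w)"
  have bij: "bij (arr y)" and ord: "\<And>a b. y b < y a \<Longrightarrow> mu (pool (arr y b)) \<le> mu (pool (arr y a))"
    using arr by (auto simp: rearrangement_def)
  obtain D where D: "map_pmf fst D = p" "map_pmf snd D = p"
    "\<And>v w c. (v, w) \<in> set_pmf D \<Longrightarrow>
       measure_pmf.prob p {v. 2 - x v < c} \<le> measure_pmf.prob p {w. 2 - ?g w < c} \<Longrightarrow>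
       2 - x v < c \<Longrightarrow> 2 - ?g w < c"
    using class_coupling[of p p "\<lambda>v. 2 - x v" "\<lambda>w. 2 - ?g w"] by blast
  have top: "measure_pmf.prob p {v. i \<le> x v} \<le> measure_pmf.prob p {w. i \<le> ?g w}"
    if "card {v. i \<le> x v} \<le> card {a. i \<le> y a}" for i
  proof -
    have "{w. i \<le> ?g w} = arr y ` {a. i \<le> y a}"
      using bij by (auto simp: bij_is_inj image_iff) (metis bij_inv_eq_iff)
    then have "card {w. i \<le> ?g w} = card {a. i \<le> y a}"
      using bij by (simp add: card_image[OF inj_on_subset[OF bij_is_inj]])
    moreover have "mu (pool v) \<le> mu (pool w)" if "v \<notin> {w. i \<le> ?g w}" "w \<in> {w. i \<le> ?g w}" for v w
      using ord[of "inv (arr y) v" "inv (arr y) w"] that bij by (simp add: surj_f_inv_f bij_is_surj)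
    ultimately have "(\<Sum>v | i \<le> x v. pmf p v) \<le> (\<Sum>w | i \<le> ?g w. pmf p w)"
      using that c nonneg by (intro sum_le_sum_top) (auto simp: p intro!: mult_left_mono)
    then show ?thesis by (simp add: measure_measure_pmf_finite)
  qed
  show ?thesis
  proof (rule that[OF D(1,2)])
    fix v w i
    assume vw: "(v, w) \<in> set_pmf D" "i \<in> {1, 2}" "card {v. i \<le> x v} \<le> card {a. i \<le> y a}" "i \<le> x v"
    have iff: "i \<le> k \<longleftrightarrow> 2 - k < 3 - i" for k :: nat using vw(2) by auto
    show "i \<le> y (inv (arr y) w)"
      using D(3)[OF vw(1), of "3 - i"] top[OF vw(3)] vw(4) unfolding iff by simp
  qed
qed

lemma jsq_shortest:
  assumes "a \<in> set_pmf (jsq y)"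
  shows "y a \<le> y b"
proof -
  have "Min (range y) \<in> range y" by (intro Min_in) auto
  then obtain a0 where "y a0 = Min (range y)" by (metis imageE)
  then have "\<forall>b. y a0 \<le> y b" by simp
  then have "{a. \<forall>b. y a \<le> y b} \<noteq> {}" by blast
  with assms show ?thesis by (simp add: jsq_def)
qed

section \<open>Coupling of the two systems\<close>

lemma pmf_bind_bernoulli:
  assumes "0 \<le> r" "r \<le> 1"
  shows "pmf (bind_pmf (bernoulli_pmf r) f) z = r * pmf (f True) z + (1 - r) * pmf (f False) z"
  using assms by (simp add: pmf_bind)

theorem proposition7p1:
  fixes M :: nat
    and mu :: "nat \<Rightarrow> real"
    and lam :: real
    and pool :: "'v::finite \<Rightarrow> nat"
    and pol :: "'v policy"
    and arr :: "('v \<Rightarrow> nat) \<Rightarrow> 'v \<Rightarrow> 'v"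
    and \<rho> :: "(('v \<Rightarrow> nat) \<times> ('v \<Rightarrow> nat)) pmf"
  assumes "\<And>v. pool v \<in> {1..M}"
    and "\<And>j k. 1 \<le> j \<Longrightarrow> j < k \<Longrightarrow> k \<le> M \<Longrightarrow> mu k < mu j"
    and "\<And>j. 1 \<le> j \<Longrightarrow> j \<le> M \<Longrightarrow> 0 < mu j"
    and "0 \<le> lam" and "lam < 1"
    and "rearrangement mu pool arr"
    and "\<And>x y a. (x, y) \<in> set_pmf \<rho> \<Longrightarrow> y a \<le> 2"
    and "\<And>x y. (x, y) \<in> set_pmf \<rho> \<Longrightarrow> Q1 M pool x = Qt 1 y"
    and "\<And>x y. (x, y) \<in> set_pmf \<rho> \<Longrightarrow> Q2plus M pool x = Qt 2 y"
    and "\<And>x y. (x, y) \<in> set_pmf \<rho> \<Longrightarrow> Qt 2 y \<le> (\<Sum>j=1..M. pool_size pool j)"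
  shows "\<exists>(\<Omega> :: (nat \<Rightarrow> real) measure) X Y.
    system_coupling lam mu pool pol arr \<rho> \<Omega> X Y \<and>
    (\<forall>\<omega>\<in>space \<Omega>. \<forall>t\<ge>0.
       Qt 1 (Y t \<omega>) + Qt 2 (Y t \<omega>) \<le> Q1 M pool (X t \<omega>) + Q2plus M pool (X t \<omega>) \<and>
       Qt 2 (Y t \<omega>) \<le> Q2plus M pool (X t \<omega>))"
proof -
  note pool = assms(1) and arr = assms(6)
  have mu: "0 < mu (pool v)" for v using assms(3)[of "pool v"] pool[of v] by auto
  define A where "A = real CARD('v) * lam"
  define S where "S = (\<Sum>v\<in>UNIV. mu (pool v))"
  define L where "L = A + S"
  have A: "0 \<le> A" using assms(4) by (simp add: A_def)
  have S: "0 < S" unfolding S_def using mu by (intro sum_pos) auto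
  have L: "0 < L" using A S by (simp add: L_def)
  have r: "0 \<le> A / L" "A / L \<le> 1" and LA: "L * (A / L) = A" and LS: "L * (1 - A / L) = S"
    using A S L by (auto simp: L_def field_simps)
  obtain p :: "'v pmf" where p: "\<And>v. pmf p v = 1 / S * mu (pool v)"
    using finite_pmf_exists[of "\<lambda>v. 1 / S * mu (pool v)"] mu S
    by (auto simp: S_def less_imp_le simp flip: sum_distrib_left sum_divide_distrib)
  have Sp: "S * pmf (map_pmf f p) z = (\<Sum>v | f v = z. mu (pool v))" for f and z :: "'v \<Rightarrow> nat"
    using S by (simp add: pmf_map measure_measure_pmf_finite p vimage_def sum_distrib_left)

  \<comment> \<open>Both systems are uniformized with the common rate \<open>L\<close>: an event is an arrival with probability
    \<open>A / L\<close> and a possible service completion otherwise. A completion at an idle server changes nothing,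
    because \<open>0 - 1 = 0\<close> on natural numbers.\<close>
  define dep :: "('v \<Rightarrow> nat) \<Rightarrow> 'v \<Rightarrow> 'v \<Rightarrow> nat" where "dep x v = x(v := x v - 1)" for x v
  define arrX where "arrX x = map_pmf (\<lambda>v. x(v := x v + 1)) (pol x)" for x
  define arrY :: "('v \<Rightarrow> nat) \<Rightarrow> ('v \<Rightarrow> nat) pmf"
    where "arrY y = map_pmf (\<lambda>a. if y a < 2 then y(a := y a + 1) else y) (jsq y)" for y
  define PX where "PX x = bind_pmf (bernoulli_pmf (A / L)) (\<lambda>b. if b then arrX x else map_pmf (dep x) p)" for x
  define PY where "PY y = bind_pmf (bernoulli_pmf (A / L))
      (\<lambda>b. if b then arrY y else map_pmf (\<lambda>w. dep y (inv (arr y) w)) p)" for y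

  have "\<forall>x y. \<exists>D. map_pmf fst D = p \<and> map_pmf snd D = p \<and>
    (\<forall>v w i. (v, w) \<in> set_pmf D \<longrightarrow> i \<in> {1, 2} \<longrightarrow> card {v. i \<le> x v} \<le> card {a. i \<le> y a} \<longrightarrow>
       i \<le> x v \<longrightarrow> i \<le> y (inv (arr y) w))"
  proof (intro allI)
    fix x y :: "'v \<Rightarrow> nat"
    show "\<exists>D. map_pmf fst D = p \<and> map_pmf snd D = p \<and>
      (\<forall>v w i. (v, w) \<in> set_pmf D \<longrightarrow> i \<in> {1, 2} \<longrightarrow> card {v. i \<le> x v} \<le> card {a. i \<le> y a} \<longrightarrow>
         i \<le> x v \<longrightarrow> i \<le> y (inv (arr y) w))"
      by (rule service_coupling[OF arr _ _ p, of x y]) (use mu S in \<open>auto simp: less_imp_le\<close>)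
  qed
  then obtain D where D: "\<And>x y. map_pmf fst (D x y) = p" "\<And>x y. map_pmf snd (D x y) = p"
    "\<And>x y v w i. (v, w) \<in> set_pmf (D x y) \<Longrightarrow> i \<in> {1, 2} \<Longrightarrow>
       card {v. i \<le> x v} \<le> card {a. i \<le> y a} \<Longrightarrow> i \<le> x v \<Longrightarrow> i \<le> y (inv (arr y) w)"
    by metis
  \<comment> \<open>Both components see the same kind of event; at an arrival the two choices of a server or queue are
    independent.\<close>
  define J where "J s = (case s of (x, y) \<Rightarrow> bind_pmf (bernoulli_pmf (A / L))
      (\<lambda>b. if b then pair_pmf (arrX x) (arrY y)
           else map_pmf (\<lambda>(v, w). (dep x v, dep y (inv (arr y) w))) (D x y)))" for s

  have lumpX: "map_pmf fst (J s) = PX (fst s)" for s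
  proof -
    obtain x y where s: "s = (x, y)" by fastforce
    have "map_pmf fst (map_pmf (\<lambda>(v, w). (dep x v, dep y (inv (arr y) w))) (D x y)) =
        map_pmf (dep x) (map_pmf fst (D x y))"
      by (simp add: pmf.map_comp comp_def split_beta')
    then show ?thesis
      unfolding J_def PX_def s
      by (auto simp: map_bind_pmf map_fst_pair_pmf D(1) if_distrib intro!: bind_pmf_cong)
  qed
  have lumpY: "map_pmf snd (J s) = PY (snd s)" for s
  proof -
    obtain x y where s: "s = (x, y)" by fastforce
    have "map_pmf snd (map_pmf (\<lambda>(v, w). (dep x v, dep y (inv (arr y) w))) (D x y)) =
        map_pmf (\<lambda>w. dep y (inv (arr y) w)) (map_pmf snd (D x y))"
      by (simp add: pmf.map_comp comp_def split_beta')
    then show ?thesis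
      unfolding J_def PY_def s
      by (auto simp: map_bind_pmf map_snd_pair_pmf D(2) if_distrib intro!: bind_pmf_cong)
  qed

  have rateX: "original_rate lam mu pool pol x x' = L * pmf (PX x) x'" if "x \<noteq> x'" for x x'
  proof -
    have "{v. 0 < x v \<and> x' = x(v := x v - 1)} = {v. dep x v = x'}"
      using that by (auto simp: dep_def fun_upd_idem_iff)
    then have "original_rate lam mu pool pol x x' = A * pmf (arrX x) x' + S * pmf (map_pmf (dep x) p) x'"
      by (simp add: original_rate_def Sp A_def arrX_def)
    also have "\<dots> = L * (A / L) * pmf (arrX x) x' + L * (1 - A / L) * pmf (map_pmf (dep x) p) x'"
      by (simp only: LA LS)
    also have "\<dots> = L * pmf (PX x) x'"
      unfolding PX_def pmf_bind_bernoulli[OF r] by (simp add: distrib_left mult.assoc)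
    finally show ?thesis .
  qed
  have rateY: "modified_rate lam mu pool arr y y' = L * pmf (PY y) y'" if "y \<noteq> y'" for y y'
  proof -
    have bij: "bij (arr y)" using arr by (simp add: rearrangement_def)
    have "{a. 0 < y a \<and> y' = y(a := y a - 1)} = {a. dep y a = y'}"
      using that by (auto simp: dep_def fun_upd_idem_iff)
    moreover have "(\<Sum>a | dep y a = y'. mu (pool (arr y a))) =
        (\<Sum>w | dep y (inv (arr y) w) = y'. mu (pool w))"
      by (rule sum.reindex_bij_witness[of _ "inv (arr y)" "arr y"])
        (use bij in \<open>auto simp: bij_is_inj bij_is_surj surj_f_inv_f\<close>)
    ultimately have "modified_rate lam mu pool arr y y' =
        A * pmf (arrY y) y' + S * pmf (map_pmf (\<lambda>w. dep y (inv (arr y) w)) p) y'"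
      by (simp add: modified_rate_def Sp A_def arrY_def)
    also have "\<dots> = L * (A / L) * pmf (arrY y) y' +
        L * (1 - A / L) * pmf (map_pmf (\<lambda>w. dep y (inv (arr y) w)) p) y'"
      by (simp only: LA LS)
    also have "\<dots> = L * pmf (PY y) y'"
      unfolding PY_def pmf_bind_bernoulli[OF r] by (simp add: distrib_left mult.assoc)
    finally show ?thesis .
  qed

  define I where "I s \<longleftrightarrow> dominated (snd s) (fst s)" for s :: "('v \<Rightarrow> nat) \<times> ('v \<Rightarrow> nat)"
  have step: "I s'" if I: "I s" and s': "s' \<in> set_pmf (J s)" for s s'
  proof -
    obtain x y where s: "s = (x, y)" by fastforce
    have dom: "dominated y x" using I by (simp add: I_def s)
    from s' have "s' \<in> set_pmf (pair_pmf (arrX x) (arrY y)) \<or>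
        s' \<in> set_pmf (map_pmf (\<lambda>(v, w). (dep x v, dep y (inv (arr y) w))) (D x y))"
      unfolding J_def s by (auto split: if_splits)
    then show ?thesis
    proof
      assume "s' \<in> set_pmf (pair_pmf (arrX x) (arrY y))"
      then obtain v a where "a \<in> set_pmf (jsq y)"
          "s' = (x(v := x v + 1), if y a < 2 then y(a := y a + 1) else y)"
        by (auto simp: arrX_def arrY_def)
      then show ?thesis
        using dominated_arrival[OF dom, of a v] jsq_shortest[of a y] by (simp add: I_def)
    next
      assume "s' \<in> set_pmf (map_pmf (\<lambda>(v, w). (dep x v, dep y (inv (arr y) w))) (D x y))"
      then obtain v w where vw: "(v, w) \<in> set_pmf (D x y)" "s' = (dep x v, dep y (inv (arr y) w))"
        by auto
      have "dominated (dep y (inv (arr y) w)) (dep x v)"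
        unfolding dep_def by (rule dominated_departure[OF dom]) (rule D(3)[OF vw(1)])
      then show ?thesis by (simp add: I_def vw)
    qed
  qed
  have init: "I s" if "s \<in> set_pmf \<rho>" for s
  proof -
    obtain x y where s: "s = (x, y)" by fastforce
    with that have xy: "(x, y) \<in> set_pmf \<rho>" by simp
    have y2: "\<And>a. y a \<le> 2" using assms(7)[OF xy] .
    have "waiting_jobs x = waiting_jobs y"
      using assms(9)[OF xy] by (simp add: Q2plus_eq_waiting_jobs[OF pool] Qt_2_eq_waiting_jobs[of y, OF y2])
    moreover have "card {v. 1 \<le> x v} = card {a. 1 \<le> y a}"
      using assms(8)[OF xy] by (simp add: Q1_eq[OF pool] Qt_def)
    ultimately show ?thesis
      using y2 by (simp add: I_def s dominated_def total_jobs_eq)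
  qed
  obtain \<Omega> :: "(nat \<Rightarrow> real) measure" and Z where
    markov: "\<And>(h :: ('v \<Rightarrow> nat) \<times> ('v \<Rightarrow> nat) \<Rightarrow> ('v \<Rightarrow> nat)) P q. (\<And>s. map_pmf h (J s) = P (h s)) \<Longrightarrow>
       (\<And>x y. x \<noteq> y \<Longrightarrow> q x y = L * pmf (P x) y) \<Longrightarrow>
       markov_jump_process \<Omega> q (\<lambda>t \<omega>. h (Z t \<omega>))"
    and init_law: "distr \<Omega> (count_space UNIV) (Z 0) = measure_pmf \<rho>"
    and inv: "\<And>t \<omega>. I (Z t \<omega>)"
    by (rule uniformized_process[OF L, of I J \<rho>]) (erule (1) step, erule init, blast)
  have "system_coupling lam mu pool pol arr \<rho> \<Omega> (\<lambda>t \<omega>. fst (Z t \<omega>)) (\<lambda>t \<omega>. snd (Z t \<omega>))"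
    unfolding system_coupling_def
    using markov[of fst PX, OF lumpX rateX] markov[of snd PY, OF lumpY rateY] init_law by simp
  moreover have "Qt 1 (snd (Z t \<omega>)) + Qt 2 (snd (Z t \<omega>)) \<le> Q1 M pool (fst (Z t \<omega>)) + Q2plus M pool (fst (Z t \<omega>)) \<and>
       Qt 2 (snd (Z t \<omega>)) \<le> Q2plus M pool (fst (Z t \<omega>))" for t \<omega>
  proof -
    let ?x = "fst (Z t \<omega>)" and ?y = "snd (Z t \<omega>)"
    have y2: "\<And>a. ?y a \<le> 2" and le: "total_jobs ?y \<le> total_jobs ?x" "waiting_jobs ?y \<le> waiting_jobs ?x"
      using inv[of t \<omega>] by (auto simp: I_def dominated_def)
    have "Qt 1 ?y + Qt 2 ?y = total_jobs ?y"
      using total_jobs_eq[of ?y] by (simp add: Qt_2_eq_waiting_jobs[of ?y, OF y2]) (simp add: Qt_def)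
    moreover have "Q1 M pool ?x + Q2plus M pool ?x = total_jobs ?x"
      by (simp add: Q1_eq[OF pool] Q2plus_eq_waiting_jobs[OF pool] total_jobs_eq)
    ultimately show ?thesis
      using le by (simp add: Qt_2_eq_waiting_jobs[of ?y, OF y2] Q2plus_eq_waiting_jobs[OF pool])
  qed
  ultimately show ?thesis by blast
qed

end
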